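(* Let $[X,\mathcal B,m,\nu]$ be a random walk space with $\nu$ reversible with respect to $m$, and let $p>1$. Then the operator $-\Delta_p^m$ is completely accretive, and for all $u,v\in L^2(X,\nu)$, $$(u,v)\in\Delta_p^m\iff (u,-v)\in\partial_{L^2(X,\nu)}\mathcal F_{p,m}(u).$$
   Context: A random walk space $[X,\mathcal B,m,\nu]$ consists of a measurable space $(X,\mathcal B)$ with $\mathcal B$ countably generated, a family $m=(m_x)_{x\in X}$ of probability measures on $\mathcal B$ such that $x\mapsto m_x(B)$ is measurable for each $B\in\mathcal B$, and a $\sigma$-finite measure $\nu$ that is invariant: $\nu(A)=\int_X m_x(A)\,d\nu(x)$ for all $A\in\mathcal B$. Reversibility means $dm_x(y)\,d\nu(x)=dm_y(x)\,d\nu(y)$ as measures on $X\times X$. $\nu\otimes m_x$ is the measure on $X\times X$ with $(\nu\otimes m_x)(A\times B)=\int_A m_x(B)\,d\nu(x)$. For $u:X\to\mathbb R$, $\nabla u(x,y)=u(y)-u(x)$. For $p\ge1$, $\mathcal F_{p,m}:L^2(X,\nu)\to[0,+\infty]$ is $\mathcal F_{p,m}(u)=\frac1{2p}\int_{X\times X}|\nabla u|^p\,d(\nu\otimes m_x)$ if this is finite, and $+\infty$ otherwise. The operator $\Delta_p^m$ ($p>1$) is the set of pairs $(u,v)$ with $u,v\in L^2(X,\nu)$, $\nabla u\in L^p(X\times X,\nu\otimes m_x)$ and $v(x)=\int_X|\nabla u(x,y)|^{p-2}\nabla u(x,y)\,dm_x(y)$ for $\nu$-a.e. $x$. For a proper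 convex functional $\mathcal F$ on a Hilbert space $H$, $\partial_H\mathcal F(u)=\{v\in H:\mathcal F(w)-\mathcal F(u)\ge (v,w-u)\ \forall w\in H\}$. An operator $A\subset L^2\times L^2$ (a multivalued map identified with its graph) is completely accretive if for all $\lambda>0$ and $(u_1,v_1),(u_2,v_2)\in A$ one has $\int_X j(u_1-u_2)\,d\nu\le\int_X j(u_1-u_2+\lambda(v_1-v_2))\,d\nu$ for every convex lower semicontinuous $j:\mathbb R\to[0,+\infty]$ with $j(0)=0$. *)

theory Defs
  imports "HOL-Probability.Probability"
begin

text \<open>A random walk space [X,B,m,nu]: X = space nu, B = sets nu, m a Markov kernel.\<close>
definition random_walk_space :: "'a measure \<Rightarrow> ('a \<Rightarrow> 'a measure) \<Rightarrow> bool" where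
  "random_walk_space \<nu> m \<longleftrightarrow>
     (\<exists>G. countable G \<and> sets \<nu> = sigma_sets (space \<nu>) G) \<and>
     (\<forall>x\<in>space \<nu>. prob_space (m x) \<and> sets (m x) = sets \<nu>) \<and>
     (\<forall>B\<in>sets \<nu>. (\<lambda>x. emeasure (m x) B) \<in> borel_measurable \<nu>) \<and>
     sigma_finite_measure \<nu> \<and>
     (\<forall>A\<in>sets \<nu>. emeasure \<nu> A = (\<integral>\<^sup>+ x. emeasure (m x) A \<partial>\<nu>))"

definition joint_measure :: "'a measure \<Rightarrow> ('a \<Rightarrow> 'a measure) \<Rightarrow> ('a \<times> 'a) measure" where
  "joint_measure \<nu> m = measure_of (space \<nu> \<times> space \<nu>) (sets (\<nu> \<Otimes>\<^sub>M \<nu>))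
     (\<lambda>C. \<integral>\<^sup>+ x. emeasure (m x) (Pair x -` C) \<partial>\<nu>)"

definition reversible :: "'a measure \<Rightarrow> ('a \<Rightarrow> 'a measure) \<Rightarrow> bool" where
  "reversible \<nu> m \<longleftrightarrow>
     distr (joint_measure \<nu> m) (\<nu> \<Otimes>\<^sub>M \<nu>) (\<lambda>(x, y). (y, x)) = joint_measure \<nu> m"

definition grad :: "('a \<Rightarrow> real) \<Rightarrow> 'a \<times> 'a \<Rightarrow> real" where
  "grad u = (\<lambda>(x, y). u y - u x)"

text \<open>Representatives of elements of L^2(X, nu).\<close>
definition L2 :: "'a measure \<Rightarrow> ('a \<Rightarrow> real) set" where
  "L2 \<nu> = {u. u \<in> borel_measurable \<nu> \<and> integrable \<nu> (\<lambda>x. (u x)\<^sup>2)}"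

definition L2_inner :: "'a measure \<Rightarrow> ('a \<Rightarrow> real) \<Rightarrow> ('a \<Rightarrow> real) \<Rightarrow> real" where
  "L2_inner \<nu> u v = (\<integral> x. u x * v x \<partial>\<nu>)"

definition F_pm :: "real \<Rightarrow> 'a measure \<Rightarrow> ('a \<Rightarrow> 'a measure) \<Rightarrow> ('a \<Rightarrow> real) \<Rightarrow> ereal" where
  "F_pm p \<nu> m u = enn2ereal (ennreal (1 / (2 * p)) *
     (\<integral>\<^sup>+ z. ennreal (\<bar>grad u z\<bar> powr p) \<partial>joint_measure \<nu> m))"

text \<open>The p-Laplacian Delta_p^m as a set of pairs of representatives.\<close>
definition p_laplacian :: "real \<Rightarrow> 'a measure \<Rightarrow> ('a \<Rightarrow> 'a measure) \<Rightarrow> (('a \<Rightarrow> real) \<times> ('a \<Rightarrow> real)) set" where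
  "p_laplacian p \<nu> m = {(u, v). u \<in> L2 \<nu> \<and> v \<in> L2 \<nu> \<and>
      integrable (joint_measure \<nu> m) (\<lambda>z. \<bar>grad u z\<bar> powr p) \<and>
      (AE x in \<nu>. v x = (\<integral> y. \<bar>grad u (x, y)\<bar> powr (p - 2) * grad u (x, y) \<partial>m x))}"

definition subdiff_L2 :: "'a measure \<Rightarrow> (('a \<Rightarrow> real) \<Rightarrow> ereal) \<Rightarrow> ('a \<Rightarrow> real) \<Rightarrow> ('a \<Rightarrow> real) set" where
  "subdiff_L2 \<nu> F u = {v \<in> L2 \<nu>. \<forall>w\<in>L2 \<nu>. F w - F u \<ge> ereal (L2_inner \<nu> v (\<lambda>x. w x - u x))}"

definition convex_ext :: "(real \<Rightarrow> ennreal) \<Rightarrow> bool" where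
  "convex_ext j \<longleftrightarrow> (\<forall>x y t. 0 \<le> t \<and> t \<le> 1 \<longrightarrow>
      j ((1 - t) * x + t * y) \<le> ennreal (1 - t) * j x + ennreal t * j y)"

definition lsc :: "(real \<Rightarrow> ennreal) \<Rightarrow> bool" where
  "lsc j \<longleftrightarrow> (\<forall>x. j x \<le> Liminf (at x) j)"

definition completely_accretive :: "'a measure \<Rightarrow> (('a \<Rightarrow> real) \<times> ('a \<Rightarrow> real)) set \<Rightarrow> bool" where
  "completely_accretive \<nu> A \<longleftrightarrow>
     (\<forall>lam::real. \<forall>u1 v1 u2 v2. lam > 0 \<and> (u1, v1) \<in> A \<and> (u2, v2) \<in> A \<longrightarrow>
       (\<forall>j. convex_ext j \<and> lsc j \<and> j 0 = 0 \<longrightarrow>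
          (\<integral>\<^sup>+ x. j (u1 x - u2 x) \<partial>\<nu>) \<le>
          (\<integral>\<^sup>+ x. j (u1 x - u2 x + lam * (v1 x - v2 x)) \<partial>\<nu>)))"

end

theory Submission
  imports Defs
begin

text \<open>
  Write \<open>\<phi>(r) = \<bar>r\<bar>\<^sup>p\<^sup>-\<^sup>2 r\<close> and let \<open>J\<close> be the joint measure, which is symmetric by reversibility. If
  \<open>h\<close> is bounded and vanishes outside a set of finite measure, then \<open>\<phi>(\<nabla>u(x,y)) h(x)\<close> is
  \<open>J\<close>-integrable and antisymmetry of \<open>\<phi>(\<nabla>u)\<close> gives
  \<open>\<integral> \<phi>(\<nabla>u) \<nabla>h dJ = - 2 \<integral> h \<Delta>u d\<nu>\<close>. For general \<open>h\<close> in \<open>L\<^sup>2\<close> with \<open>\<nabla>h\<close> in \<open>L\<^sup>p\<close> the two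
  halves of the left-hand side need not be integrable separately, so \<open>h\<close> is approximated by
  1-Lipschitz truncations, which do not increase \<open>\<bar>\<nabla>h\<bar>\<close>.

  The tangent inequality \<open>\<bar>b\<bar>\<^sup>p \<ge> \<bar>a\<bar>\<^sup>p + p \<phi>(a) (b - a)\<close> then shows that the operator is
  contained in the subdifferential. Conversely, testing the subdifferential inequality with
  \<open>u + t h\<close> and letting \<open>t\<close> tend to 0, with \<open>h = - sgn (v - \<Delta>u)\<close> on a set of finite measure, forces
  \<open>v = \<Delta>u\<close>.

  For complete accretivity, the integrand \<open>j\<close> is approximated from below by finite convex functions
  that vanish near 0 and have bounded monotone subgradients \<open>q\<close>. Since \<open>\<phi>\<close> and \<open>q\<close> are
  nondecreasing, testing with \<open>q (u\<^sub>1 - u\<^sub>2)\<close> gives the inequality for these approximants, and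
  Fatou's lemma gives it for \<open>j\<close>.
\<close>

section \<open>The flux function\<close>

text \<open>The derivative of \<open>\<bar>r\<bar> powr p / p\<close>. Since
  \<open>0 powr a = 0\<close>, its value at 0 is 0 also for p < 2, where the exponent p - 2 is
  negative.\<close>

definition pflux :: "real \<Rightarrow> real \<Rightarrow> real" where
  "pflux p r = \<bar>r\<bar> powr (p - 2) * r"

text \<open>The exponent p - 1 is positive, so in this form the singularity for p < 2 is gone;
  continuity and monotonicity are read off from it.\<close>

lemma pflux_eq: "pflux p r = sgn r * \<bar>r\<bar> powr (p - 1)"
proof (cases "r = 0")
  case False
  then have "\<bar>r\<bar> powr (p - 1) = \<bar>r\<bar> powr (p - 2) * \<bar>r\<bar>"
    using powr_add[of "\<bar>r\<bar>" "p - 2" 1] by simp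
  then show ?thesis by (simp add: pflux_def sgn_if)
qed (simp add: pflux_def)

lemma pflux_minus [simp]: "pflux p (- r) = - pflux p r"
  by (simp add: pflux_def)

lemma abs_pflux: "\<bar>pflux p r\<bar> = \<bar>r\<bar> powr (p - 1)"
  by (cases "r = 0") (auto simp: pflux_eq abs_mult abs_sgn_eq)

lemma pflux_mult_self: "pflux p r * r = \<bar>r\<bar> powr p"
proof (cases "r = 0")
  case False
  then have "\<bar>r\<bar> powr p = \<bar>r\<bar> powr (p - 2) * \<bar>r\<bar>\<^sup>2"
    using powr_add[of "\<bar>r\<bar>" "p - 2" 2] by simp
  then show ?thesis by (simp add: pflux_def power2_eq_square)
qed (simp add: pflux_def)

lemma pflux_mono:
  assumes "1 < p" "r \<le> s"
  shows "pflux p r \<le> pflux p s"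
proof -
  consider "0 \<le> r" | "r \<le> 0" "0 \<le> s" | "s \<le> 0" using assms by linarith
  then show ?thesis
  proof cases
    case 1 then show ?thesis using assms by (auto simp: pflux_eq sgn_if intro: powr_mono2)
  next
    case 2
    have "pflux p r \<le> 0" "0 \<le> pflux p s"
      using 2 by (auto simp: pflux_def mult_nonneg_nonpos)
    then show ?thesis by linarith
  next
    case 3
    have "(- s) powr (p - 1) \<le> (- r) powr (p - 1)" using 3 assms by (intro powr_mono2) auto
    with 3 assms show ?thesis by (auto simp: pflux_eq sgn_if abs_if)
  qed
qed

lemma continuous_pflux:
  assumes "1 < p" shows "continuous_on UNIV (pflux p)"
proof -
  have "continuous_on {0..} (pflux p)"
  proof -
    have "continuous_on {0..} (\<lambda>r::real. r powr (p - 1))"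
      using assms by (intro continuous_on_powr' continuous_intros) auto
    then show ?thesis
      by (rule continuous_on_eq) (auto simp: pflux_eq sgn_if)
  qed
  moreover have "continuous_on {..0} (pflux p)"
  proof -
    have "continuous_on {..0} (\<lambda>r::real. - ((- r) powr (p - 1)))"
      using assms by (intro continuous_on_powr' continuous_intros) auto
    then show ?thesis
      by (rule continuous_on_eq) (auto simp: pflux_eq sgn_if)
  qed
  moreover have "{0..} \<union> {..0::real} = UNIV" by auto
  ultimately show ?thesis
    using continuous_on_closed_Un[of "{0..}" "{..0::real}" "pflux p"] by auto
qed

text \<open>Young's inequality for \<open>\<bar>b\<bar>\<close> and
  \<open>\<bar>a\<bar> powr (p - 1)\<close> with the conjugate exponent p / (p - 1), under which the
  second factor becomes \<open>\<bar>a\<bar> powr p\<close>. No differentiation at 0 is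
  involved.\<close>

lemma powr_tangent_le:
  assumes "1 < p"
  shows "\<bar>a\<bar> powr p + p * pflux p a * (b - a) \<le> \<bar>b\<bar> powr p"
proof -
  define q where "q = p / (p - 1)"
  have q: "q > 1" "1 / p + 1 / q = 1" using assms by (auto simp: q_def field_simps)
  have "(\<bar>a\<bar> powr (p - 1)) powr q = \<bar>a\<bar> powr p"
    using assms by (simp add: powr_powr q_def)
  then have "\<bar>b\<bar> * \<bar>a\<bar> powr (p - 1) \<le> \<bar>b\<bar> powr p / p + \<bar>a\<bar> powr p / q"
    using Youngs_inequality[OF assms q, of "\<bar>b\<bar>" "\<bar>a\<bar> powr (p - 1)"] by simp
  moreover have "pflux p a * b \<le> \<bar>b\<bar> * \<bar>a\<bar> powr (p - 1)"
    using abs_ge_self[of "pflux p a * b"] by (simp add: abs_mult abs_pflux mult.commute)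
  ultimately have "p * (pflux p a * b) \<le> p * (\<bar>b\<bar> powr p / p + \<bar>a\<bar> powr p / q)"
    using assms by (intro mult_left_mono) auto
  also have "\<dots> = \<bar>b\<bar> powr p + (p - 1) * \<bar>a\<bar> powr p"
    using assms by (simp add: q_def field_simps)
  finally show ?thesis
    using pflux_mult_self[of p a] by (simp add: algebra_simps)
qed

text \<open>The constant 1 pays for small r, where the exponent p - 1 gives more than p. It is
  integrable only against functions such as test functions.\<close>

lemma abs_pflux_le:
  assumes "1 < p" shows "\<bar>pflux p r\<bar> \<le> 1 + \<bar>r\<bar> powr p"
proof (cases "\<bar>r\<bar> \<le> 1")
  case True
  then have "\<bar>r\<bar> powr (p - 1) \<le> 1" using assms by (intro powr_le1) auto
  then show ?thesis unfolding abs_pflux by (smt (verit) powr_ge_zero)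
next
  case False
  then have "\<bar>r\<bar> powr (p - 1) \<le> \<bar>r\<bar> powr p" by (intro powr_mono) auto
  then show ?thesis by (simp add: abs_pflux)
qed

text \<open>Both factors are compared with the larger of \<open>\<bar>a\<bar>\<close> and
  \<open>\<bar>b\<bar>\<close>. This supplies integrable majorants where Hoelder's inequality would
  otherwise be used.\<close>

lemma abs_pflux_mult_le:
  assumes "1 < p" shows "\<bar>pflux p a * b\<bar> \<le> \<bar>a\<bar> powr p + \<bar>b\<bar> powr p"
proof -
  define c where "c = max \<bar>a\<bar> \<bar>b\<bar>"
  have "\<bar>pflux p a * b\<bar> = \<bar>a\<bar> powr (p - 1) * \<bar>b\<bar>" by (simp add: abs_mult abs_pflux)
  also have "\<dots> \<le> c powr (p - 1) * c"
    using assms by (intro mult_mono powr_mono2) (auto simp: c_def)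
  also have "\<dots> = c powr p"
    using powr_add[of c "p - 1" 1] by (cases "c = 0") (auto simp: c_def)
  also have "\<dots> \<le> \<bar>a\<bar> powr p + \<bar>b\<bar> powr p" by (auto simp: c_def max_def)
  finally show ?thesis .
qed

lemma abs_add_powr_le:
  fixes a b p :: real
  assumes "1 < p" shows "\<bar>a + b\<bar> powr p \<le> 2 powr p * (\<bar>a\<bar> powr p + \<bar>b\<bar> powr p)"
proof -
  define c where "c = max \<bar>a\<bar> \<bar>b\<bar>"
  have "\<bar>a + b\<bar> powr p \<le> (2 * c) powr p"
    using assms by (intro powr_mono2) (auto simp: c_def)
  also have "\<dots> = 2 powr p * c powr p" by (simp add: powr_mult c_def)
  also have "\<dots> \<le> 2 powr p * (\<bar>a\<bar> powr p + \<bar>b\<bar> powr p)"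
    by (intro mult_left_mono) (auto simp: c_def max_def)
  finally show ?thesis .
qed

section \<open>Convex lower semicontinuous integrands\<close>

text \<open>Taking only real heights places the epigraph in a Euclidean plane, where hyperplane
  separation is available although \<open>j\<close> may take the value infinity.\<close>

lemma convex_epigraph_ennreal:
  assumes "convex_ext j" shows "convex {(t, y::real). 0 \<le> y \<and> j t \<le> ennreal y}"
proof -
  have "0 \<le> u * y1 + v * y2 \<and> j (u * t1 + v * t2) \<le> ennreal (u * y1 + v * y2)"
    if *: "0 \<le> u" "0 \<le> v" "u + v = 1" "0 \<le> y1" "0 \<le> y2"
      "j t1 \<le> ennreal y1" "j t2 \<le> ennreal y2" for t1 y1 t2 y2 u v :: real
  proof -
    have u: "u = 1 - v" and "v \<le> 1" using * by simp_all
    then have "j (u * t1 + v * t2) \<le> ennreal u * j t1 + ennreal v * j t2"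
      using assms *(2) unfolding convex_ext_def u by blast
    also have "\<dots> \<le> ennreal u * ennreal y1 + ennreal v * ennreal y2"
      using * by (intro add_mono mult_left_mono) auto
    also have "\<dots> = ennreal (u * y1 + v * y2)"
      using * by (simp add: ennreal_mult)
    finally show ?thesis using * by simp
  qed
  then show ?thesis unfolding convex_def by auto
qed

lemma closed_epigraph_ennreal:
  assumes "lsc j" shows "closed {(t, y::real). 0 \<le> y \<and> j t \<le> ennreal y}" (is "closed ?E")
proof (unfold closed_sequential_limits, intro allI impI, elim conjE)
  fix z :: "nat \<Rightarrow> real \<times> real" and l
  assume z: "\<forall>n. z n \<in> ?E" and lim: "z \<longlonglongrightarrow> l"
  have f: "(\<lambda>n. fst (z n)) \<longlonglongrightarrow> fst l" and s: "(\<lambda>n. snd (z n)) \<longlonglongrightarrow> snd l"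
    using lim by (auto intro: tendsto_fst tendsto_snd)
  have zE: "0 \<le> snd (z n)" "j (fst (z n)) \<le> ennreal (snd (z n))" for n
    using z by (auto simp: case_prod_beta)
  have "0 \<le> snd l" using s zE(1) by (intro LIMSEQ_le_const) auto
  moreover have "j (fst l) \<le> ennreal (snd l)"
  proof (rule ccontr)
    assume "\<not> j (fst l) \<le> ennreal (snd l)"
    then obtain c where c: "ennreal (snd l) < c" "c < j (fst l)"
      by (meson dense not_le)
    then have "\<forall>\<^sub>F x in at (fst l). c < j x"
      using assms le_Liminf_iff[of "j (fst l)" "at (fst l)" j] by (simp add: lsc_def)
    \<comment> \<open>\<open>lsc\<close> speaks of punctured neighbourhoods, but the sequence may
      hit its limit; there the bound is \<open>c < j (fst l)\<close> itself.\<close>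
    then have "\<forall>\<^sub>F x in nhds (fst l). c < j x"
      using c(2) by (auto simp: eventually_at_filter elim!: eventually_mono)
    then have "\<forall>\<^sub>F n in sequentially. c < j (fst (z n))"
      using f by (rule eventually_compose_filterlim)
    moreover have "\<forall>\<^sub>F n in sequentially. ennreal (snd (z n)) < c"
      using tendsto_ennrealI[OF s] c(1) by (rule order_tendstoD)
    ultimately have "\<forall>\<^sub>F n in sequentially. False"
      by eventually_elim (use zE(2) in \<open>meson not_le order.strict_trans order.strict_trans2\<close>)
    then show False by simp
  qed
  ultimately show "l \<in> ?E" by (auto simp: case_prod_beta)
qed

text \<open>Separate the point (s, c), which lies strictly below the graph, from the closed convex
  epigraph. Strict separation from the origin, which is in the epigraph, makes the offset
  \<open>b\<close> positive, so the minorant is negative near 0.\<close>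

lemma convex_lsc_affine_minorant:
  assumes j: "convex_ext j" "lsc j" "j 0 = 0" and c: "0 \<le> c" "ennreal c < j s"
  obtains a b where "0 < b" "c < a * s - b" "\<And>t. ennreal (a * t - b) \<le> j t"
proof -
  let ?E = "{(t, y::real). 0 \<le> y \<and> j t \<le> ennreal y}"
  have "(s, c) \<notin> ?E" using c by auto
  then obtain n \<beta> where n: "n \<bullet> (s, c) < \<beta>" "\<And>z. z \<in> ?E \<Longrightarrow> \<beta> < n \<bullet> z"
    using separating_hyperplane_closed_point[OF convex_epigraph_ennreal[OF j(1)]
      closed_epigraph_ennreal[OF j(2)], of "(s, c)"] by auto
  obtain \<alpha> \<gamma> where ng: "n = (\<alpha>, \<gamma>)" by (cases n)
  have sc: "\<alpha> * s + \<gamma> * c < \<beta>" using n(1) ng by simp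
  have E: "\<beta> < \<alpha> * t + \<gamma> * y" if "0 \<le> y" "j t \<le> ennreal y" for t y
    using n(2)[of "(t, y)"] that ng by simp
  have b: "\<beta> < 0" using E[of 0 0] j(3) by simp
  have g: "0 \<le> \<gamma>"
  proof (rule ccontr)
    assume "\<not> 0 \<le> \<gamma>"
    \<comment> \<open>The point of height \<open>\<beta> / \<gamma> > 0\<close> above the origin is
      in the epigraph but lies on the hyperplane.\<close>
    then show False using E[of "\<beta> / \<gamma>" 0] b j(3) by (simp add: field_simps)
  qed
  show thesis
  proof (cases "\<gamma> = 0")
    case False
    with g have g: "0 < \<gamma>" by simp
    show thesis
    proof (rule that[of "- \<beta> / \<gamma>" "- \<alpha> / \<gamma>"])
      show "0 < - \<beta> / \<gamma>" "c < - \<alpha> / \<gamma> * s - - \<beta> / \<gamma>"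
        using b g sc by (auto simp: field_simps)
      show "ennreal (- \<alpha> / \<gamma> * t - - \<beta> / \<gamma>) \<le> j t" for t
      proof (cases "j t")
        case (real y)
        then have "- \<alpha> / \<gamma> * t - - \<beta> / \<gamma> \<le> y"
          using E[of y t] g by (simp add: field_simps)
        then show ?thesis using real by (simp add: ennreal_leI)
      qed simp
    qed
  next
    case True
    \<comment> \<open>A vertical hyperplane separates \<open>s\<close> from the effective domain; any multiple of it is a minorant.\<close>
    define k where "k = (c + 1) / (\<beta> - \<alpha> * s)"
    have k: "0 < k" "k * (\<beta> - \<alpha> * s) = c + 1" using sc c True by (auto simp: k_def)
    show thesis
    proof (rule that[of "- k * \<beta>" "- k * \<alpha>"])
      show "0 < - k * \<beta>" using k b by (simp add: mult_pos_neg)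
      show "c < - k * \<alpha> * s - - k * \<beta>" using k by (simp add: algebra_simps)
      show "ennreal (- k * \<alpha> * t - - k * \<beta>) \<le> j t" for t
      proof (cases "j t")
        case (real y)
        then have "k * (\<beta> - \<alpha> * t) \<le> 0"
          using E[of y t] k True by (simp add: mult_nonneg_nonpos)
        then have "ennreal (- k * \<alpha> * t - - k * \<beta>) = 0"
          by (intro ennreal_neg) (simp add: algebra_simps)
        then show ?thesis by simp
      qed simp
    qed
  qed
qed

text \<open>Coefficients of affine minorants of \<open>j\<close>, cut down to a compact set. The
  pair (0, 0) makes the supremum nonnegative; the lower bound on the other offsets keeps their
  functions negative on a neighbourhood of 0 depending only on n.\<close>

definition truncated_minorants :: "(real \<Rightarrow> ennreal) \<Rightarrow> nat \<Rightarrow> (real \<times> real) set" where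
  "truncated_minorants j n = insert (0, 0) ({- real n..real n} \<times> {1 / real n..real n} \<inter>
     {(a, b). \<forall>t. ennreal (a * t - b) \<le> j t})"

lemma compact_truncated_minorants: "compact (truncated_minorants j n)"
proof -
  have "closed {z. ennreal (fst z * t - snd z) \<le> j t}" for t
    by (intro closed_Collect_le continuous_intros continuous_on_ennreal)
  then have "closed (\<Inter>t. {z. ennreal (fst z * t - snd z) \<le> j t})" by blast
  also have "(\<Inter>t. {z. ennreal (fst z * t - snd z) \<le> j t}) = {(a, b). \<forall>t. ennreal (a * t - b) \<le> j t}"
    by auto
  finally show ?thesis
    unfolding truncated_minorants_def by (intro compact_insert compact_Int_closed compact_Times) auto
qed

text \<open>The approximants are suprema of affine functions over a compact set of coefficients; the
  slope \<open>q\<close> of a maximiser is a subgradient. All the affine functions other than \<open>0\<close> are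
  negative near the origin, so \<open>q\<close> vanishes there.\<close>

lemma convex_lsc_approx:
  assumes j: "convex_ext j" "lsc j" "j 0 = 0"
  obtains f q :: "nat \<Rightarrow> real \<Rightarrow> real" where
    "\<And>n s t. f n s + q n s * (t - s) \<le> f n t"
    "\<And>n s. 0 \<le> f n s" "\<And>n s. ennreal (f n s) \<le> j s"
    "\<And>s. j s \<le> liminf (\<lambda>n. ennreal (f n s))"
    "\<And>n s. \<bar>q n s\<bar> \<le> real n"
    "\<And>n s. real n * real n * \<bar>s\<bar> < 1 \<Longrightarrow> f n s = 0 \<and> q n s = 0"
proof -
  let ?K = "truncated_minorants j"
  have "\<exists>z\<in>?K n. \<forall>z'\<in>?K n. fst z' * s - snd z' \<le> fst z * s - snd z" for n s
    by (intro continuous_attains_sup compact_truncated_minorants continuous_intros)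
      (auto simp: truncated_minorants_def)
  then obtain z where zK: "\<And>n s. z n s \<in> ?K n" and
    z: "\<And>n s z'. z' \<in> ?K n \<Longrightarrow> fst z' * s - snd z' \<le> fst (z n s) * s - snd (z n s)" by metis
  define f where "f n s = fst (z n s) * s - snd (z n s)" for n s
  define q where "q n s = fst (z n s)" for n s
  have K0: "(0, 0) \<in> ?K n" for n by (simp add: truncated_minorants_def)
  show thesis
  proof (rule that[of f q])
    show "f n s + q n s * (t - s) \<le> f n t" for n s t
      using z[OF zK[of n s], of t] by (simp add: f_def q_def algebra_simps)
    show f0: "0 \<le> f n s" for n s using z[OF K0, of s n] by (simp add: f_def)
    show "ennreal (f n s) \<le> j s" for n s
      using zK[of n s] by (auto simp: f_def truncated_minorants_def)
    show "\<bar>q n s\<bar> \<le> real n" for n s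
      using zK[of n s] by (auto simp: q_def truncated_minorants_def)
    show "f n s = 0 \<and> q n s = 0" if "real n * real n * \<bar>s\<bar> < 1" for n s
    proof -
      have False if "z n s \<noteq> (0, 0)"
      proof -
        obtain a b where ab: "z n s = (a, b)" by (cases "z n s")
        have *: "\<bar>a\<bar> \<le> n" "1 / real n \<le> b" "b \<le> n"
          using zK[of n s] that ab by (auto simp: truncated_minorants_def)
        \<comment> \<open>As 1 / 0 = 0, the only pair for n = 0 is (0, 0), which is excluded
          here.\<close>
        have n: "0 < n"
          using * \<open>real n * real n * \<bar>s\<bar> < 1\<close> zK[of n s] that ab
          by (cases "n = 0") (auto simp: truncated_minorants_def)
        \<comment> \<open>So close to 0 the function with coefficients (a, b) is negative, hence
          worse than the zero function and not a maximiser.\<close>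
        have "a * s \<le> real n * \<bar>s\<bar>"
          using abs_ge_self[of "a * s"] mult_right_mono[OF *(1), of "\<bar>s\<bar>"] by (simp add: abs_mult)
        also have "\<dots> < 1 / n" using \<open>real n * real n * \<bar>s\<bar> < 1\<close> n by (simp add: field_simps)
        finally show False using *(2) f0[of n s] ab by (simp add: f_def)
      qed
      then have "z n s = (0, 0)" by blast
      then show ?thesis by (simp add: f_def q_def)
    qed
    show "j s \<le> liminf (\<lambda>n. ennreal (f n s))" for s
      unfolding le_Liminf_iff
    proof safe
      fix c assume c: "c < j s"
      then have "c \<noteq> \<top>" by auto
      then obtain r where r: "c = ennreal r" "0 \<le> r" by (cases c) auto
      obtain a b where ab: "0 < b" "r < a * s - b" "\<And>t. ennreal (a * t - b) \<le> j t"
        using convex_lsc_affine_minorant[OF j r(2)] c r by blast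
      obtain N where N: "max (max \<bar>a\<bar> b) (1 / b) < real N" using reals_Archimedean2 by blast
      show "\<forall>\<^sub>F n in sequentially. c < ennreal (f n s)"
      proof (rule eventually_sequentiallyI[of N])
        fix n assume "N \<le> n"
        then have n: "\<bar>a\<bar> < n" "b < n" "1 / b < n" using N by auto
        have "1 / real n \<le> b" using n ab(1) by (simp add: field_simps)
        then have "(a, b) \<in> ?K n" using n ab(3) by (auto simp: truncated_minorants_def)
        from z[OF this, of s] have "r < f n s" using ab(2) by (simp add: f_def)
        then show "c < ennreal (f n s)" using r by (simp add: ennreal_lessI)
      qed
    qed
  qed
qed

section \<open>Square-integrable functions and test functions\<close>

lemma L2_mult_integrable:
  assumes "u \<in> L2 \<nu>" "v \<in> L2 \<nu>"
  shows "integrable \<nu> (\<lambda>x. u x * v x)"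
proof (rule Bochner_Integration.integrable_bound)
  show "integrable \<nu> (\<lambda>x. (u x)\<^sup>2 + (v x)\<^sup>2)" using assms by (auto simp: L2_def)
  show "(\<lambda>x. u x * v x) \<in> borel_measurable \<nu>" using assms by (auto simp: L2_def)
  have "\<bar>a * b\<bar> \<le> a\<^sup>2 + b\<^sup>2" for a b :: real
    using zero_le_power2[of "\<bar>a\<bar> - \<bar>b\<bar>"] mult_nonneg_nonneg[of "\<bar>a\<bar>" "\<bar>b\<bar>"]
    unfolding power2_diff power2_abs abs_mult by linarith
  then show "AE x in \<nu>. norm (u x * v x) \<le> norm ((u x)\<^sup>2 + (v x)\<^sup>2)" by simp
qed

lemma L2_add_cmult:
  assumes "u \<in> L2 \<nu>" "v \<in> L2 \<nu>"
  shows "(\<lambda>x. u x + c * v x) \<in> L2 \<nu>"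
proof -
  have "integrable \<nu> (\<lambda>x. (u x)\<^sup>2 + (2 * c) * (u x * v x) + c\<^sup>2 * (v x)\<^sup>2)"
    using L2_mult_integrable[OF assms] assms by (auto simp: L2_def)
  moreover have "(\<lambda>x. (u x)\<^sup>2 + (2 * c) * (u x * v x) + c\<^sup>2 * (v x)\<^sup>2) = (\<lambda>x. (u x + c * v x)\<^sup>2)"
    by (auto simp: power2_eq_square algebra_simps)
  ultimately show ?thesis using assms by (auto simp: L2_def)
qed

lemma L2_diff:
  assumes "u \<in> L2 \<nu>" "v \<in> L2 \<nu>"
  shows "(\<lambda>x. u x - v x) \<in> L2 \<nu>"
  using L2_add_cmult[OF assms, of "- 1"] by simp

text \<open>Chebyshev's inequality for the square of \<open>u\<close>. As the measure of the whole
  space may be infinite, supports of finite measure are obtained by cutting off small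
  values.\<close>

lemma L2_finite_superlevel:
  assumes "u \<in> L2 \<nu>" "0 < e"
  shows "emeasure \<nu> {x \<in> space \<nu>. e \<le> \<bar>u x\<bar>} < \<infinity>"
proof -
  have [measurable]: "u \<in> borel_measurable \<nu>" and i: "integrable \<nu> (\<lambda>x. (u x)\<^sup>2)"
    using assms by (auto simp: L2_def)
  have "{x \<in> space \<nu>. e \<le> \<bar>u x\<bar>} \<subseteq> {x \<in> space \<nu>. 1 \<le> ennreal (1 / e\<^sup>2) * ennreal ((u x)\<^sup>2)}"
  proof safe
    fix x assume "e \<le> \<bar>u x\<bar>"
    then have "e\<^sup>2 \<le> (u x)\<^sup>2" using assms(2) abs_le_square_iff[of e "u x"] by simp
    then have "ennreal 1 \<le> ennreal (1 / e\<^sup>2 * (u x)\<^sup>2)"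
      using assms(2) by (intro ennreal_leI) (simp add: field_simps)
    then show "1 \<le> ennreal (1 / e\<^sup>2) * ennreal ((u x)\<^sup>2)"
      by (subst ennreal_mult[symmetric]) auto
  qed
  then have "emeasure \<nu> {x \<in> space \<nu>. e \<le> \<bar>u x\<bar>}
      \<le> emeasure \<nu> {x \<in> space \<nu>. 1 \<le> ennreal (1 / e\<^sup>2) * ennreal ((u x)\<^sup>2)}"
    by (intro emeasure_mono) auto
  also have "\<dots> \<le> ennreal (1 / e\<^sup>2) * (\<integral>\<^sup>+x. ennreal ((u x)\<^sup>2) * indicator (space \<nu>) x \<partial>\<nu>)"
    by (intro nn_integral_Markov_inequality) auto
  also have "(\<integral>\<^sup>+x. ennreal ((u x)\<^sup>2) * indicator (space \<nu>) x \<partial>\<nu>) = (\<integral>\<^sup>+x. ennreal ((u x)\<^sup>2) \<partial>\<nu>)"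
    by (intro nn_integral_cong) auto
  also have "\<dots> = ennreal (\<integral>x. (u x)\<^sup>2 \<partial>\<nu>)" by (intro nn_integral_eq_integral i) auto
  also have "ennreal (1 / e\<^sup>2) * \<dots> < \<infinity>" by (simp add: ennreal_mult_less_top)
  finally show ?thesis .
qed

definition test_function :: "'a measure \<Rightarrow> ('a \<Rightarrow> real) \<Rightarrow> bool" where
  "test_function \<nu> h \<longleftrightarrow> h \<in> borel_measurable \<nu> \<and> (\<exists>C. \<forall>x\<in>space \<nu>. \<bar>h x\<bar> \<le> C) \<and>
     emeasure \<nu> {x \<in> space \<nu>. h x \<noteq> 0} < \<infinity>"

text \<open>\<open>F 0 = 0\<close> keeps the composite zero off a set of finite measure, and
  \<open>G s\<close> bounds \<open>F\<close> on [-s, s]. It is applied to squares, absolute values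
  and p-th powers.\<close>

lemma test_function_comp_integrable:
  fixes F :: "real \<Rightarrow> real"
  assumes "test_function \<nu> h" and F [measurable]: "F \<in> borel_measurable borel"
    and "F 0 = 0" "\<And>r s. \<bar>r\<bar> \<le> s \<Longrightarrow> \<bar>F r\<bar> \<le> G s"
  shows "integrable \<nu> (\<lambda>x. F (h x))"
proof -
  obtain C where C: "\<forall>x\<in>space \<nu>. \<bar>h x\<bar> \<le> C" and [measurable]: "h \<in> borel_measurable \<nu>"
    using assms by (auto simp: test_function_def)
  show ?thesis
  proof (rule integrableI_bounded_set[where A = "{x \<in> space \<nu>. h x \<noteq> 0}" and B = "G C"])
    show "AE x in \<nu>. x \<in> {x \<in> space \<nu>. h x \<noteq> 0} \<longrightarrow> norm (F (h x)) \<le> G C"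
      using C assms(4) by auto
    show "AE x in \<nu>. x \<notin> {x \<in> space \<nu>. h x \<noteq> 0} \<longrightarrow> F (h x) = 0"
      using assms(3) by (intro AE_I2) auto
  qed (use assms in \<open>auto simp: test_function_def\<close>)
qed

lemma test_function_in_L2:
  assumes "test_function \<nu> h" shows "h \<in> L2 \<nu>"
proof -
  have "integrable \<nu> (\<lambda>x. (h x)\<^sup>2)"
    by (rule test_function_comp_integrable[OF assms, of "\<lambda>r. r\<^sup>2" "\<lambda>s. s\<^sup>2"])
      (auto simp: abs_le_square_iff[symmetric])
  with assms show ?thesis by (auto simp: L2_def test_function_def)
qed

text \<open>The support lies in a superlevel set of \<open>\<bar>u\<bar>\<close>. This provides both
  the truncations of an L^2 function and the test function \<open>q (u1 - u2)\<close> for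
  accretivity.\<close>

lemma test_function_comp_L2:
  assumes u: "u \<in> L2 \<nu>" and f: "f \<in> borel_measurable borel" and "0 < e"
    and b: "\<And>r. \<bar>f r\<bar> \<le> C" and z: "\<And>r. \<bar>r\<bar> < e \<Longrightarrow> f r = 0"
  shows "test_function \<nu> (\<lambda>x. f (u x))"
proof -
  have [measurable]: "u \<in> borel_measurable \<nu>" "f \<in> borel_measurable borel"
    using u f by (auto simp: L2_def)
  have "emeasure \<nu> {x \<in> space \<nu>. f (u x) \<noteq> 0} \<le> emeasure \<nu> {x \<in> space \<nu>. e \<le> \<bar>u x\<bar>}"
    using z by (intro emeasure_mono) (auto simp: not_less[symmetric])
  also have "\<dots> < \<infinity>" using L2_finite_superlevel[OF u \<open>0 < e\<close>] .
  finally show ?thesis using b by (auto simp: test_function_def)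
qed

section \<open>The joint measure and Green's formula\<close>

locale random_walk =
  fixes \<nu> :: "'a measure" and m :: "'a \<Rightarrow> 'a measure"
  assumes random_walk: "random_walk_space \<nu> m"
begin

abbreviation J :: "('a \<times> 'a) measure" where "J \<equiv> joint_measure \<nu> m"

lemma kernel_prob: "x \<in> space \<nu> \<Longrightarrow> prob_space (m x)"
  and kernel_sets: "x \<in> space \<nu> \<Longrightarrow> sets (m x) = sets \<nu>"
  using random_walk by (auto simp: random_walk_space_def)

lemma kernel_space: "x \<in> space \<nu> \<Longrightarrow> space (m x) = space \<nu>"
  by (intro sets_eq_imp_space_eq kernel_sets)

lemma kernel_measurable [measurable]: "m \<in> measurable \<nu> (subprob_algebra \<nu>)"
  using random_walk
  by (intro measurable_subprob_algebra)
    (auto simp: random_walk_space_def intro: prob_space_imp_subprob_space)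

lemma pair_kernel_measurable [measurable]:
  "(\<lambda>x. distr (m x) (\<nu> \<Otimes>\<^sub>M \<nu>) (Pair x)) \<in> measurable \<nu> (subprob_algebra (\<nu> \<Otimes>\<^sub>M \<nu>))"
  by (rule measurable_distr2[where M = \<nu>]) auto

lemma Pair_measurable_kernel: "x \<in> space \<nu> \<Longrightarrow> Pair x \<in> measurable (m x) (\<nu> \<Otimes>\<^sub>M \<nu>)"
  by (subst measurable_cong_sets[OF kernel_sets refl]) auto

lemma measurable_kernel_section:
  "f \<in> measurable (\<nu> \<Otimes>\<^sub>M \<nu>) N \<Longrightarrow> x \<in> space \<nu> \<Longrightarrow> (\<lambda>y. f (x, y)) \<in> measurable (m x) N"
  by (rule measurable_compose[OF Pair_measurable_kernel])

lemma sets_joint [measurable_cong]: "sets J = sets (\<nu> \<Otimes>\<^sub>M \<nu>)"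
  unfolding joint_measure_def space_pair_measure[symmetric] by (rule sets.sets_measure_of_eq)

lemma space_joint: "space J = space \<nu> \<times> space \<nu>"
  by (simp add: sets_eq_imp_space_eq[OF sets_joint] space_pair_measure)

text \<open>The set function inside \<open>measure_of\<close> is recognised as that of a monadic
  bind, hence is countably additive, and the integration rules for \<open>bind\<close> become
  available.\<close>

lemma joint_eq_bind:
  assumes "space \<nu> \<noteq> {}"
  shows "J = \<nu> \<bind> (\<lambda>x. distr (m x) (\<nu> \<Otimes>\<^sub>M \<nu>) (Pair x))" (is "_ = ?B")
proof -
  have sets: "sets ?B = sets (\<nu> \<Otimes>\<^sub>M \<nu>)" by (rule sets_bind) (auto simp: assms)
  have space: "space ?B = space \<nu> \<times> space \<nu>"
    by (simp add: sets_eq_imp_space_eq[OF sets] space_pair_measure)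
  have "J = measure_of (space ?B) (sets ?B) (emeasure ?B)"
    unfolding joint_measure_def sets space
  proof (rule measure_of_eq)
    show "sets (\<nu> \<Otimes>\<^sub>M \<nu>) \<subseteq> Pow (space \<nu> \<times> space \<nu>)"
      using sets.space_closed[of "\<nu> \<Otimes>\<^sub>M \<nu>"] by (simp add: space_pair_measure)
    fix C assume "C \<in> sigma_sets (space \<nu> \<times> space \<nu>) (sets (\<nu> \<Otimes>\<^sub>M \<nu>))"
    then have C: "C \<in> sets (\<nu> \<Otimes>\<^sub>M \<nu>)"
      using sets.sigma_sets_eq[of "\<nu> \<Otimes>\<^sub>M \<nu>"] by (simp add: space_pair_measure)
    have "emeasure ?B C = (\<integral>\<^sup>+ x. emeasure (distr (m x) (\<nu> \<Otimes>\<^sub>M \<nu>) (Pair x)) C \<partial>\<nu>)"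
      by (rule emeasure_bind[OF assms pair_kernel_measurable C])
    also have "\<dots> = (\<integral>\<^sup>+ x. emeasure (m x) (Pair x -` C) \<partial>\<nu>)"
    proof (rule nn_integral_cong)
      fix x assume x: "x \<in> space \<nu>"
      have "Pair x -` C \<inter> space (m x) = Pair x -` C"
        using sets.sets_into_space[OF C] x kernel_space by (auto simp: space_pair_measure)
      then show "emeasure (distr (m x) (\<nu> \<Otimes>\<^sub>M \<nu>) (Pair x)) C = emeasure (m x) (Pair x -` C)"
        using emeasure_distr[OF Pair_measurable_kernel[OF x] C] by simp
    qed
    finally show "(\<integral>\<^sup>+ x. emeasure (m x) (Pair x -` C) \<partial>\<nu>) = emeasure ?B C" ..
  qed
  then show ?thesis by (simp only: measure_of_of_measure)
qed

lemma nn_integral_joint: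
  assumes f [measurable]: "f \<in> borel_measurable (\<nu> \<Otimes>\<^sub>M \<nu>)"
  shows "(\<integral>\<^sup>+ z. f z \<partial>J) = (\<integral>\<^sup>+ x. \<integral>\<^sup>+ y. f (x, y) \<partial>m x \<partial>\<nu>)"
proof (cases "space \<nu> = {}")
  case True
  then show ?thesis by (simp add: nn_integral_empty space_joint)
next
  case False
  show ?thesis
    unfolding joint_eq_bind[OF False] nn_integral_bind[OF f pair_kernel_measurable]
    by (intro nn_integral_cong nn_integral_distr Pair_measurable_kernel) auto
qed

lemma nn_integral_kernel_measurable:
  assumes [measurable]: "f \<in> borel_measurable (\<nu> \<Otimes>\<^sub>M \<nu>)"
  shows "(\<lambda>x. \<integral>\<^sup>+ y. f (x, y) \<partial>m x) \<in> borel_measurable \<nu>"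
  by (rule nn_integral_measurable_subprob_algebra2[where N = \<nu>]) auto

lemma integral_kernel_measurable:
  fixes f :: "'a \<times> 'a \<Rightarrow> real"
  assumes f [measurable]: "f \<in> borel_measurable (\<nu> \<Otimes>\<^sub>M \<nu>)"
  shows "(\<lambda>x. \<integral> y. f (x, y) \<partial>m x) \<in> borel_measurable \<nu>"
proof -
  have "(\<lambda>x. integral\<^sup>L (distr (m x) (\<nu> \<Otimes>\<^sub>M \<nu>) (Pair x)) f) \<in> borel_measurable \<nu>"
    by (rule measurable_compose[OF pair_kernel_measurable integral_measurable_subprob_algebra[OF f]])
  then show ?thesis
    by (rule measurable_cong[THEN iffD1, rotated])
      (simp add: integral_distr[OF Pair_measurable_kernel f])
qed

text \<open>Fubini's theorem for a kernel: Tonelli is applied to the positive part \<open>P\<close>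
  and the negative part \<open>N\<close>, whose inner integrals are finite almost
  everywhere.\<close>

lemma
  fixes f :: "'a \<times> 'a \<Rightarrow> real"
  assumes int: "integrable J f"
  shows AE_integrable_kernel: "AE x in \<nu>. integrable (m x) (\<lambda>y. f (x, y))" (is ?A)
    and integrable_kernel: "integrable \<nu> (\<lambda>x. \<integral> y. f (x, y) \<partial>m x)" (is ?B)
    and integral_joint: "(\<integral> z. f z \<partial>J) = (\<integral> x. \<integral> y. f (x, y) \<partial>m x \<partial>\<nu>)" (is ?C)
proof -
  have f [measurable]: "f \<in> borel_measurable (\<nu> \<Otimes>\<^sub>M \<nu>)"
    using borel_measurable_integrable[OF int] by (simp add: measurable_cong_sets[OF sets_joint refl])
  define P where "P x = (\<integral>\<^sup>+ y. ennreal (f (x, y)) \<partial>m x)" for x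
  define N where "N x = (\<integral>\<^sup>+ y. ennreal (- f (x, y)) \<partial>m x)" for x
  have [measurable]: "P \<in> borel_measurable \<nu>" "N \<in> borel_measurable \<nu>"
    unfolding P_def N_def by (intro nn_integral_kernel_measurable; simp)+
  have P: "(\<integral>\<^sup>+ x. P x \<partial>\<nu>) = (\<integral>\<^sup>+ z. ennreal (f z) \<partial>J)"
    and N: "(\<integral>\<^sup>+ x. N x \<partial>\<nu>) = (\<integral>\<^sup>+ z. ennreal (- f z) \<partial>J)"
    unfolding P_def N_def by (intro nn_integral_joint[symmetric]; simp)+
  have fin: "(\<integral>\<^sup>+ x. P x \<partial>\<nu>) \<noteq> \<infinity>" "(\<integral>\<^sup>+ x. N x \<partial>\<nu>) \<noteq> \<infinity>"
    using int unfolding P N real_integrable_def by auto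
  have AEP: "AE x in \<nu>. P x \<noteq> \<infinity>" and AEN: "AE x in \<nu>. N x \<noteq> \<infinity>"
    by (intro nn_integral_PInf_AE fin; simp)+
  show A: ?A
    using AEP AEN AE_space
  proof eventually_elim
    case (elim x)
    then show ?case
      using measurable_kernel_section[OF f] unfolding real_integrable_def P_def N_def by auto
  qed
  \<comment> \<open>\<open>enn2real\<close> sends infinity to 0, which changes \<open>P\<close> only
    on a null set.\<close>
  have eP: "(\<integral>\<^sup>+ x. ennreal (enn2real (P x)) \<partial>\<nu>) = (\<integral>\<^sup>+ x. P x \<partial>\<nu>)"
    using AEP by (intro nn_integral_cong_AE) (auto elim!: eventually_mono simp: less_top)
  have eN: "(\<integral>\<^sup>+ x. ennreal (enn2real (N x)) \<partial>\<nu>) = (\<integral>\<^sup>+ x. N x \<partial>\<nu>)"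
    using AEN by (intro nn_integral_cong_AE) (auto elim!: eventually_mono simp: less_top)
  have iP: "integrable \<nu> (\<lambda>x. enn2real (P x))"
    using fin eP by (intro integrableI_nonneg) (auto simp: less_top)
  have iN: "integrable \<nu> (\<lambda>x. enn2real (N x))"
    using fin eN by (intro integrableI_nonneg) (auto simp: less_top)
  have AE: "AE x in \<nu>. enn2real (P x) - enn2real (N x) = (\<integral> y. f (x, y) \<partial>m x)"
    using A by eventually_elim (simp add: real_lebesgue_integral_def P_def N_def)
  have km: "(\<lambda>x. \<integral> y. f (x, y) \<partial>m x) \<in> borel_measurable \<nu>"
    by (rule integral_kernel_measurable) simp
  show ?B
    using integrable_cong_AE[OF _ km AE] iP iN by auto
  have "(\<integral> x. \<integral> y. f (x, y) \<partial>m x \<partial>\<nu>) = (\<integral> x. enn2real (P x) - enn2real (N x) \<partial>\<nu>)"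
    using AE by (intro integral_cong_AE km) (auto elim: eventually_mono)
  also have "\<dots> = (\<integral> x. enn2real (P x) \<partial>\<nu>) - (\<integral> x. enn2real (N x) \<partial>\<nu>)"
    using iP iN by simp
  also have "\<dots> = (\<integral> z. f z \<partial>J)"
    using eP eN P N by (simp add: integral_eq_nn_integral real_lebesgue_integral_def[OF int])
  finally show ?C ..
qed

lemma nn_integral_joint_fst:
  assumes [measurable]: "f \<in> borel_measurable \<nu>"
  shows "(\<integral>\<^sup>+ z. f (fst z) \<partial>J) = (\<integral>\<^sup>+ x. f x \<partial>\<nu>)"
proof -
  have "(\<integral>\<^sup>+ z. f (fst z) \<partial>J) = (\<integral>\<^sup>+ x. \<integral>\<^sup>+ y. f x \<partial>m x \<partial>\<nu>)"
    by (subst nn_integral_joint) auto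
  also have "\<dots> = (\<integral>\<^sup>+ x. f x \<partial>\<nu>)"
    by (intro nn_integral_cong) (simp add: prob_space.emeasure_space_1[OF kernel_prob])
  finally show ?thesis .
qed

lemma integrable_joint_fst:
  fixes f :: "'a \<Rightarrow> real"
  assumes "integrable \<nu> f" shows "integrable J (\<lambda>z. f (fst z))"
proof -
  have [measurable]: "f \<in> borel_measurable \<nu>" using assms by auto
  show ?thesis
    using assms nn_integral_joint_fst[of "\<lambda>x. ennreal (norm (f x))"]
    unfolding integrable_iff_bounded by auto
qed

lemma measurable_grad [measurable]:
  assumes "u \<in> borel_measurable \<nu>"
  shows "grad u \<in> borel_measurable (\<nu> \<Otimes>\<^sub>M \<nu>)"
  unfolding grad_def case_prod_beta
  by (intro borel_measurable_diff measurable_compose[OF _ assms] measurable_fst measurable_snd)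

text \<open>In the bound on \<open>g\<close>, the summand 1 is absorbed by the integrability of
  \<open>h\<close> and the summand \<open>G\<close> by its boundedness.\<close>

lemma integrable_flux_test:
  assumes g [measurable]: "g \<in> borel_measurable (\<nu> \<Otimes>\<^sub>M \<nu>)" and h: "test_function \<nu> h"
    and G: "integrable J G" "\<And>z. \<bar>g z\<bar> \<le> 1 + G z"
  shows "integrable J (\<lambda>z. g z * h (fst z))"
proof -
  obtain C where C: "\<forall>x\<in>space \<nu>. \<bar>h x\<bar> \<le> C" and [measurable]: "h \<in> borel_measurable \<nu>"
    using h by (auto simp: test_function_def)
  have "integrable J (\<lambda>z. \<bar>h (fst z)\<bar>)"
    by (rule integrable_joint_fst, rule test_function_comp_integrable[OF h, of abs "\<lambda>s. s"]) auto
  then have "integrable J (\<lambda>z. \<bar>h (fst z)\<bar> + C * \<bar>G z\<bar>)" using G(1) by auto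
  then show ?thesis
  proof (rule Bochner_Integration.integrable_bound)
    show "(\<lambda>z. g z * h (fst z)) \<in> borel_measurable J" by measurable
    show "AE z in J. norm (g z * h (fst z)) \<le> norm (\<bar>h (fst z)\<bar> + C * \<bar>G z\<bar>)"
    proof (rule AE_I2)
      fix z assume "z \<in> space J"
      then have c: "\<bar>h (fst z)\<bar> \<le> C" using C by (auto simp: space_joint)
      have "\<bar>g z * h (fst z)\<bar> \<le> (1 + \<bar>G z\<bar>) * \<bar>h (fst z)\<bar>"
        unfolding abs_mult using G(2)[of z] by (intro mult_right_mono) auto
      also have "\<dots> \<le> \<bar>h (fst z)\<bar> + C * \<bar>G z\<bar>"
        using mult_left_mono[OF c, of "\<bar>G z\<bar>"] by (simp add: algebra_simps)
      finally show "norm (g z * h (fst z)) \<le> norm (\<bar>h (fst z)\<bar> + C * \<bar>G z\<bar>)" by simp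
    qed
  qed
qed

end

section \<open>Symmetry of the joint measure\<close>

locale reversible_random_walk = random_walk +
  assumes reversible: "reversible \<nu> m"
begin

lemma swap_joint: "distr J (\<nu> \<Otimes>\<^sub>M \<nu>) prod.swap = J"
proof -
  have "(prod.swap :: 'a \<times> 'a \<Rightarrow> _) = (\<lambda>(x, y). (y, x))" by auto
  then show ?thesis using reversible unfolding reversible_def by simp
qed

lemma swap_measurable_joint: "prod.swap \<in> measurable J (\<nu> \<Otimes>\<^sub>M \<nu>)"
proof -
  have "(prod.swap :: 'a \<times> 'a \<Rightarrow> _) = (\<lambda>z. (snd z, fst z))" by auto
  moreover have "(\<lambda>z. (snd z, fst z)) \<in> measurable J (\<nu> \<Otimes>\<^sub>M \<nu>)" by measurable
  ultimately show ?thesis by simp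
qed

lemma integrable_swap:
  fixes f :: "'a \<times> 'a \<Rightarrow> real"
  assumes "integrable J f" shows "integrable J (\<lambda>z. f (prod.swap z))"
  using integrable_distr[OF swap_measurable_joint, of f] assms by (simp add: swap_joint)

lemma integral_swap:
  fixes f :: "'a \<times> 'a \<Rightarrow> real"
  assumes "integrable J f" shows "(\<integral> z. f (prod.swap z) \<partial>J) = (\<integral> z. f z \<partial>J)"
proof -
  have "f \<in> borel_measurable (\<nu> \<Otimes>\<^sub>M \<nu>)"
    using borel_measurable_integrable[OF assms] by (simp add: measurable_cong_sets[OF sets_joint refl])
  from integral_distr[OF swap_measurable_joint this] show ?thesis by (simp add: swap_joint)
qed

text \<open>By antisymmetry, \<open>g (x, y) * h y\<close> is the negative of the swapped
  \<open>g (x, y) * h x\<close>. Symmetry of \<open>J\<close> therefore makes it integrable too, and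
  both halves contribute the same amount, whence the factor 2.\<close>

lemma
  assumes anti: "\<And>x y. g (y, x) = - g (x, y)"
    and int: "integrable J (\<lambda>z. g z * h (fst z))"
  shows Green_integrable_divergence: "integrable \<nu> (\<lambda>x. h x * (\<integral> y. g (x, y) \<partial>m x))"
    and Green: "(\<integral> z. g z * grad h z \<partial>J) = - 2 * (\<integral> x. h x * (\<integral> y. g (x, y) \<partial>m x) \<partial>\<nu>)"
proof -
  have eq: "g z * grad h z = - (g (prod.swap z) * h (fst (prod.swap z))) - g z * h (fst z)" for z
  proof (cases z)
    case (Pair x y)
    then show ?thesis by (simp add: grad_def anti[of y x] algebra_simps)
  qed
  have "(\<integral> z. g z * grad h z \<partial>J) = - 2 * (\<integral> z. g z * h (fst z) \<partial>J)"
    unfolding eq using int integrable_swap[OF int] integral_swap[OF int] by simp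
  also have "(\<integral> z. g z * h (fst z) \<partial>J) = (\<integral> x. h x * (\<integral> y. g (x, y) \<partial>m x) \<partial>\<nu>)"
    unfolding integral_joint[OF int] by (simp add: mult.commute)
  finally show "(\<integral> z. g z * grad h z \<partial>J) = - 2 * (\<integral> x. h x * (\<integral> y. g (x, y) \<partial>m x) \<partial>\<nu>)" .
  show "integrable \<nu> (\<lambda>x. h x * (\<integral> y. g (x, y) \<partial>m x))"
    using integrable_kernel[OF int] by (simp add: mult.commute)
qed

text \<open>The p-th power of \<open>h\<close> is integrable in the first variable because
  \<open>J\<close> has first marginal \<open>\<nu>\<close>, and in the second by symmetry.\<close>

lemma integrable_grad_test_powr:
  assumes p: "1 < p" and h: "test_function \<nu> h"
  shows "integrable J (\<lambda>z. \<bar>grad h z\<bar> powr p)"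
proof -
  have [measurable]: "h \<in> borel_measurable \<nu>" using h by (auto simp: test_function_def)
  have i: "integrable J (\<lambda>z. \<bar>h (fst z)\<bar> powr p)"
    using p by (intro integrable_joint_fst test_function_comp_integrable[OF h, of "\<lambda>r. \<bar>r\<bar> powr p" "\<lambda>s. s powr p"])
      (auto intro: powr_mono2)
  from integrable_swap[OF i] have "integrable J (\<lambda>z. 2 powr p * (\<bar>h (snd z)\<bar> powr p + \<bar>h (fst z)\<bar> powr p))"
    using i by simp
  then show ?thesis
  proof (rule Bochner_Integration.integrable_bound)
    show "AE z in J. norm (\<bar>grad h z\<bar> powr p) \<le> norm (2 powr p * (\<bar>h (snd z)\<bar> powr p + \<bar>h (fst z)\<bar> powr p))"
      using abs_add_powr_le[OF p, of "h (snd z)" "- h (fst z)" for z]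
      by (auto simp: grad_def case_prod_beta)
  qed measurable
qed

end

section \<open>The p-Laplacian\<close>

lemma pflux_measurable [measurable]: "1 < p \<Longrightarrow> pflux p \<in> borel_measurable borel"
  by (rule borel_measurable_continuous_onI[OF continuous_pflux])

lemma nn_integral_eq_top:
  fixes f :: "'a \<Rightarrow> real"
  assumes "f \<in> borel_measurable M" "\<not> integrable M f" "\<And>x. 0 \<le> f x"
  shows "(\<integral>\<^sup>+ x. ennreal (f x) \<partial>M) = \<top>"
proof (rule ccontr)
  assume "(\<integral>\<^sup>+ x. ennreal (f x) \<partial>M) \<noteq> \<top>"
  then have "(\<integral>\<^sup>+ x. ennreal (f x) \<partial>M) < \<infinity>" unfolding infinity_ennreal_def less_top .
  with assms show False using integrableI_nonneg[of f M] by blast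
qed

section \<open>Lipschitz truncations\<close>

text \<open>For e <= c this is soft thresholding: zero up to modulus e, then a shift by e towards 0,
  constant beyond modulus c. A sharp cutoff at e would jump and could enlarge gradients.\<close>

definition soft_truncation :: "real \<Rightarrow> real \<Rightarrow> real \<Rightarrow> real" where
  "soft_truncation e c s = max (- c) (min c s) - max (- e) (min e s)"

lemma soft_truncation_measurable [measurable]: "soft_truncation e c \<in> borel_measurable borel"
  unfolding soft_truncation_def[abs_def] by measurable

text \<open>The function is nondecreasing with slope at most 1. Hence truncating \<open>h\<close>
  cannot increase \<open>\<bar>grad h z\<bar>\<close>, which is what dominated convergence
  requires.\<close>

lemma soft_truncation_lipschitz:
  assumes "0 < e" "e \<le> c"
  shows "\<bar>soft_truncation e c s - soft_truncation e c t\<bar> \<le> \<bar>s - t\<bar>"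
proof -
  have "0 \<le> soft_truncation e c y - soft_truncation e c x"
    "soft_truncation e c y - soft_truncation e c x \<le> y - x" if "x \<le> y" for x y
    using assms that unfolding soft_truncation_def by linarith+
  from this[of s t] this[of t s] show ?thesis by linarith
qed

lemma abs_soft_truncation_le:
  assumes "0 < e" "e \<le> c" shows "\<bar>soft_truncation e c s\<bar> \<le> \<bar>s\<bar>"
  using assms unfolding soft_truncation_def by linarith

lemma test_function_soft_truncation:
  assumes "h \<in> L2 \<nu>" "0 < e" "e \<le> c"
  shows "test_function \<nu> (\<lambda>x. soft_truncation e c (h x))"
proof (rule test_function_comp_L2[OF assms(1) soft_truncation_measurable assms(2)])
  show "\<bar>soft_truncation e c r\<bar> \<le> c" for r
    using assms(2,3) unfolding soft_truncation_def by linarith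
  show "soft_truncation e c r = 0" if "\<bar>r\<bar> < e" for r
    using assms(2,3) that unfolding soft_truncation_def by linarith
qed

lemma soft_truncation_tendsto:
  "(\<lambda>n. soft_truncation (1 / real (Suc n)) (real (Suc n)) s) \<longlonglongrightarrow> s"
proof -
  have bound: "\<bar>soft_truncation e c s - s\<bar> \<le> e" if "0 < e" "\<bar>s\<bar> \<le> c" for e c
    using that unfolding soft_truncation_def by linarith
  obtain N where N: "\<bar>s\<bar> < real N" using reals_Archimedean2 by blast
  have "\<forall>\<^sub>F n in sequentially.
      norm (soft_truncation (1 / real (Suc n)) (real (Suc n)) s - s) \<le> inverse (real (Suc n))"
  proof (rule eventually_sequentiallyI[of N])
    fix n assume "N \<le> n"
    then have "\<bar>s\<bar> \<le> real (Suc n)" using N by simp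
    then show "norm (soft_truncation (1 / real (Suc n)) (real (Suc n)) s - s) \<le> inverse (real (Suc n))"
      unfolding inverse_eq_divide real_norm_def by (intro bound) auto
  qed
  then have "(\<lambda>n. soft_truncation (1 / real (Suc n)) (real (Suc n)) s - s) \<longlonglongrightarrow> 0"
    using LIMSEQ_inverse_real_of_nat by (rule Lim_null_comparison)
  then show ?thesis by (simp add: LIM_zero_iff)
qed

lemma pflux_grad_swap: "pflux p (grad u (y, x)) = - pflux p (grad u (x, y))"
  unfolding pflux_minus[symmetric] by (simp add: grad_def)

section \<open>Finite energy and integrability of the flux\<close>

context random_walk
begin

lemma F_pm_eq_ereal:
  assumes p: "1 < p" and int: "integrable J (\<lambda>z. \<bar>grad u z\<bar> powr p)"
  shows "F_pm p \<nu> m u = ereal ((\<integral> z. \<bar>grad u z\<bar> powr p \<partial>J) / (2 * p))"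
proof -
  have "(\<integral>\<^sup>+ z. ennreal (\<bar>grad u z\<bar> powr p) \<partial>J) = ennreal (\<integral> z. \<bar>grad u z\<bar> powr p \<partial>J)"
    by (rule nn_integral_eq_integral[OF int]) auto
  then show ?thesis
    using p by (simp add: F_pm_def ennreal_mult[symmetric])
qed

lemma F_pm_eq_infinity:
  assumes p: "1 < p" and [measurable]: "u \<in> borel_measurable \<nu>"
    and nint: "\<not> integrable J (\<lambda>z. \<bar>grad u z\<bar> powr p)"
  shows "F_pm p \<nu> m u = \<infinity>"
proof -
  have "(\<lambda>z. \<bar>grad u z\<bar> powr p) \<in> borel_measurable J" by measurable
  then have "(\<integral>\<^sup>+ z. ennreal (\<bar>grad u z\<bar> powr p) \<partial>J) = \<top>"
    using nint by (rule nn_integral_eq_top) simp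
  then show ?thesis
    using p by (simp add: F_pm_def ennreal_mult_top)
qed

lemma integrable_grad_add_cmult_powr:
  assumes p: "1 < p" and [measurable]: "u \<in> borel_measurable \<nu>" "h \<in> borel_measurable \<nu>"
    and int: "integrable J (\<lambda>z. \<bar>grad u z\<bar> powr p)" "integrable J (\<lambda>z. \<bar>grad h z\<bar> powr p)"
  shows "integrable J (\<lambda>z. \<bar>grad u z + c * grad h z\<bar> powr p)"
proof (rule Bochner_Integration.integrable_bound)
  show "integrable J (\<lambda>z. 2 powr p * (\<bar>grad u z\<bar> powr p + \<bar>c\<bar> powr p * \<bar>grad h z\<bar> powr p))"
    using int by auto
  show "AE z in J. norm (\<bar>grad u z + c * grad h z\<bar> powr p)
      \<le> norm (2 powr p * (\<bar>grad u z\<bar> powr p + \<bar>c\<bar> powr p * \<bar>grad h z\<bar> powr p))"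
    using abs_add_powr_le[OF p, of "grad u z" "c * grad h z" for z] by (auto simp: abs_mult powr_mult)
qed measurable

lemma integrable_pflux_mult:
  assumes p: "1 < p" and [measurable]: "u \<in> borel_measurable \<nu>" "h \<in> borel_measurable \<nu>"
    and int: "integrable J (\<lambda>z. \<bar>grad u z\<bar> powr p)" "integrable J (\<lambda>z. \<bar>grad h z\<bar> powr p)"
  shows "integrable J (\<lambda>z. pflux p (grad u z) * grad h z)"
proof (rule Bochner_Integration.integrable_bound)
  show "integrable J (\<lambda>z. \<bar>grad u z\<bar> powr p + \<bar>grad h z\<bar> powr p)" using int by auto
  note pflux_measurable[OF p, measurable]
  show "(\<lambda>z. pflux p (grad u z) * grad h z) \<in> borel_measurable J" by measurable
  show "AE z in J. norm (pflux p (grad u z) * grad h z) \<le> norm (\<bar>grad u z\<bar> powr p + \<bar>grad h z\<bar> powr p)"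
    using abs_pflux_mult_le[OF p] by auto
qed

lemma integrable_pflux_test:
  assumes p: "1 < p" and [measurable]: "u \<in> borel_measurable \<nu>"
    and int: "integrable J (\<lambda>z. \<bar>grad u z\<bar> powr p)" and h: "test_function \<nu> h"
  shows "integrable J (\<lambda>z. pflux p (grad u z) * h (fst z))"
proof (rule integrable_flux_test[OF _ h int])
  note pflux_measurable[OF p, measurable]
  show "(\<lambda>z. pflux p (grad u z)) \<in> borel_measurable (\<nu> \<Otimes>\<^sub>M \<nu>)" by measurable
qed (rule abs_pflux_le[OF p])

end

section \<open>Weak form of the p-Laplacian\<close>

lemma p_laplacianD:
  assumes "(u, v) \<in> p_laplacian p \<nu> m"
  shows "u \<in> L2 \<nu>" "v \<in> L2 \<nu>" "u \<in> borel_measurable \<nu>" "v \<in> borel_measurable \<nu>"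
    "integrable (joint_measure \<nu> m) (\<lambda>z. \<bar>grad u z\<bar> powr p)"
    "AE x in \<nu>. v x = (\<integral> y. pflux p (grad u (x, y)) \<partial>m x)"
  using assms by (auto simp: p_laplacian_def pflux_def L2_def)

context reversible_random_walk
begin

lemma p_laplacian_weak_test:
  assumes p: "1 < p" and uv: "(u, v) \<in> p_laplacian p \<nu> m" and h: "test_function \<nu> h"
  shows "(\<integral> z. pflux p (grad u z) * grad h z \<partial>J) = - 2 * (\<integral> x. h x * v x \<partial>\<nu>)"
proof -
  note D = p_laplacianD[OF uv]
  note pflux_measurable[OF p, measurable] D(3,4)[measurable]
  have [measurable]: "h \<in> borel_measurable \<nu>" using h by (simp add: test_function_def)
  have *: "integrable J (\<lambda>z. pflux p (grad u z) * h (fst z))"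
    by (rule integrable_pflux_test[OF p D(3,5) h])
  have "(\<integral> z. pflux p (grad u z) * grad h z \<partial>J)
      = - 2 * (\<integral> x. h x * (\<integral> y. pflux p (grad u (x, y)) \<partial>m x) \<partial>\<nu>)"
    by (rule Green[OF pflux_grad_swap *])
  also have "(\<integral> x. h x * (\<integral> y. pflux p (grad u (x, y)) \<partial>m x) \<partial>\<nu>) = (\<integral> x. h x * v x \<partial>\<nu>)"
  proof (rule integral_cong_AE)
    have [measurable]: "(\<lambda>x. \<integral> y. pflux p (grad u (x, y)) \<partial>m x) \<in> borel_measurable \<nu>"
      by (rule integral_kernel_measurable) measurable
    show "(\<lambda>x. h x * (\<integral> y. pflux p (grad u (x, y)) \<partial>m x)) \<in> borel_measurable \<nu>" by measurable
    show "AE x in \<nu>. h x * (\<integral> y. pflux p (grad u (x, y)) \<partial>m x) = h x * v x"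
      using D(6) by eventually_elim simp
  qed measurable
  finally show ?thesis .
qed

text \<open>Dominated convergence along truncations of \<open>h\<close>: the limiting integrands
  themselves are the majorants, on \<open>J\<close> because \<open>u\<close> and \<open>h\<close>
  have finite energy, on \<open>\<nu>\<close> because \<open>h\<close> and \<open>v\<close> are in
  L^2.\<close>

lemma p_laplacian_weak:
  assumes p: "1 < p" and uv: "(u, v) \<in> p_laplacian p \<nu> m"
    and h: "h \<in> L2 \<nu>" "integrable J (\<lambda>z. \<bar>grad h z\<bar> powr p)"
  shows "(\<integral> z. pflux p (grad u z) * grad h z \<partial>J) = - 2 * (\<integral> x. h x * v x \<partial>\<nu>)"
proof -
  note D = p_laplacianD[OF uv]
  note pflux_measurable[OF p, measurable] D(3,4)[measurable]
  have [measurable]: "h \<in> borel_measurable \<nu>" using h by (simp add: L2_def)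
  define h' where "h' n x = soft_truncation (1 / real (Suc n)) (real (Suc n)) (h x)" for n x
  have Suc: "0 < 1 / real (Suc n)" "1 / real (Suc n) \<le> real (Suc n)" for n
    by (auto simp: field_simps)
  have [measurable]: "h' n \<in> borel_measurable \<nu>" for n unfolding h'_def by measurable
  have "(\<lambda>n. \<integral> z. pflux p (grad u z) * grad (h' n) z \<partial>J)
      \<longlonglongrightarrow> (\<integral> z. pflux p (grad u z) * grad h z \<partial>J)"
  proof (rule integral_dominated_convergence)
    show "integrable J (\<lambda>z. norm (pflux p (grad u z) * grad h z))"
      using integrable_pflux_mult[OF p D(3) _ D(5) h(2)] by simp
    show "AE z in J. (\<lambda>n. pflux p (grad u z) * grad (h' n) z) \<longlonglongrightarrow> pflux p (grad u z) * grad h z"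
      unfolding grad_def h'_def case_prod_beta
      by (intro AE_I2 tendsto_intros soft_truncation_tendsto)
    show "AE z in J. norm (pflux p (grad u z) * grad (h' n) z) \<le> norm (pflux p (grad u z) * grad h z)" for n
      using soft_truncation_lipschitz[OF Suc]
      by (intro AE_I2) (auto simp: grad_def h'_def case_prod_beta abs_mult intro!: mult_left_mono)
  qed measurable
  moreover have "(\<lambda>n. \<integral> x. h' n x * v x \<partial>\<nu>) \<longlonglongrightarrow> (\<integral> x. h x * v x \<partial>\<nu>)"
  proof (rule integral_dominated_convergence)
    show "integrable \<nu> (\<lambda>x. norm (h x * v x))"
      using L2_mult_integrable[OF h(1) D(2)] by simp
    show "AE x in \<nu>. (\<lambda>n. h' n x * v x) \<longlonglongrightarrow> h x * v x"
      unfolding h'_def by (intro AE_I2 tendsto_intros soft_truncation_tendsto)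
    show "AE x in \<nu>. norm (h' n x * v x) \<le> norm (h x * v x)" for n
      using abs_soft_truncation_le[OF Suc]
      by (intro AE_I2) (auto simp: h'_def abs_mult intro!: mult_right_mono)
  qed measurable
  then have "(\<lambda>n. - 2 * (\<integral> x. h' n x * v x \<partial>\<nu>)) \<longlonglongrightarrow> - 2 * (\<integral> x. h x * v x \<partial>\<nu>)"
    by (intro tendsto_intros)
  moreover have "(\<integral> z. pflux p (grad u z) * grad (h' n) z \<partial>J) = - 2 * (\<integral> x. h' n x * v x \<partial>\<nu>)" for n
    using p_laplacian_weak_test[OF p uv test_function_soft_truncation[OF h(1) Suc]]
    unfolding h'_def .
  ultimately show ?thesis by (simp add: LIMSEQ_unique)
qed

section \<open>Inclusion in the subdifferential\<close>

lemma p_laplacian_imp_subdiff: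
  assumes p: "1 < p" and uv: "(u, v) \<in> p_laplacian p \<nu> m"
  shows "(\<lambda>x. - v x) \<in> subdiff_L2 \<nu> (F_pm p \<nu> m) u"
  unfolding subdiff_L2_def
proof (intro CollectI conjI ballI)
  note D = p_laplacianD[OF uv]
  show "(\<lambda>x. - v x) \<in> L2 \<nu>" using D(2) by (simp add: L2_def)
  fix w assume w: "w \<in> L2 \<nu>"
  then have wm: "w \<in> borel_measurable \<nu>" by (simp add: L2_def)
  let ?h = "\<lambda>x. w x - u x"
  show "ereal (L2_inner \<nu> (\<lambda>x. - v x) ?h) \<le> F_pm p \<nu> m w - F_pm p \<nu> m u"
  proof (cases "integrable J (\<lambda>z. \<bar>grad w z\<bar> powr p)")
    case False
    then show ?thesis by (simp add: F_pm_eq_infinity[OF p wm] F_pm_eq_ereal[OF p D(5)])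
  next
    case True
    have h: "?h \<in> L2 \<nu>" by (rule L2_diff[OF w D(1)])
    have gh: "grad ?h z = grad w z - grad u z" for z by (cases z) (simp add: grad_def)
    have ih: "integrable J (\<lambda>z. \<bar>grad ?h z\<bar> powr p)"
      using integrable_grad_add_cmult_powr[OF p wm D(3) True D(5), of "- 1"] by (simp add: gh)
    have i: "integrable J (\<lambda>z. pflux p (grad u z) * grad ?h z)"
      using h by (intro integrable_pflux_mult[OF p D(3) _ D(5) ih]) (simp add: L2_def)
    \<comment> \<open>The weak form evaluates the left side as -2 p times the integral of
      \<open>?h\<close> times \<open>v\<close>; this matches the normalisation 1 / (2 p) of the
      energy.\<close>
    have "(\<integral> z. p * (pflux p (grad u z) * grad ?h z) \<partial>J)
        \<le> (\<integral> z. \<bar>grad w z\<bar> powr p - \<bar>grad u z\<bar> powr p \<partial>J)"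
    proof (rule integral_mono)
      show "p * (pflux p (grad u z) * grad ?h z) \<le> \<bar>grad w z\<bar> powr p - \<bar>grad u z\<bar> powr p" for z
        using powr_tangent_le[OF p, of "grad u z" "grad w z"] by (simp add: gh)
    qed (use i D(5) True in auto)
    then have "- (2 * p) * (\<integral> x. ?h x * v x \<partial>\<nu>)
        \<le> (\<integral> z. \<bar>grad w z\<bar> powr p \<partial>J) - (\<integral> z. \<bar>grad u z\<bar> powr p \<partial>J)"
      using D(5) True p_laplacian_weak[OF p uv h ih] by simp
    then have "- (\<integral> x. ?h x * v x \<partial>\<nu>)
        \<le> (\<integral> z. \<bar>grad w z\<bar> powr p \<partial>J) / (2 * p) - (\<integral> z. \<bar>grad u z\<bar> powr p \<partial>J) / (2 * p)"
      using p by (simp add: field_simps)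
    moreover have "L2_inner \<nu> (\<lambda>x. - v x) ?h = - (\<integral> x. ?h x * v x \<partial>\<nu>)"
      by (simp add: L2_inner_def mult.commute)
    ultimately show ?thesis
      by (simp add: F_pm_eq_ereal[OF p True] F_pm_eq_ereal[OF p D(5)])
  qed
qed

section \<open>Converse inclusion\<close>

text \<open>Compare with the zero function, of energy 0: if \<open>u\<close> had infinite energy, a
  real number would be at most minus infinity. The competitor must have finite energy, since
  infinity minus infinity is infinity in \<open>ereal\<close>.\<close>

lemma subdiff_imp_integrable_grad:
  assumes p: "1 < p" and u: "u \<in> L2 \<nu>" and v: "v \<in> subdiff_L2 \<nu> (F_pm p \<nu> m) u"
  shows "integrable J (\<lambda>z. \<bar>grad u z\<bar> powr p)"
proof (rule ccontr)
  assume "\<not> ?thesis"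
  then have "F_pm p \<nu> m u = \<infinity>" using u by (intro F_pm_eq_infinity[OF p]) (auto simp: L2_def)
  moreover have "F_pm p \<nu> m (\<lambda>x. 0) = ereal 0"
    using F_pm_eq_ereal[OF p, of "\<lambda>x. 0"] by (simp add: grad_def case_prod_beta)
  moreover have "(\<lambda>x. 0) \<in> L2 \<nu>" by (simp add: L2_def)
  ultimately show False
    using v unfolding subdiff_L2_def by fastforce
qed

text \<open>First variation along \<open>u + t h\<close> for t > 0 tending to 0. Only an inequality
  is derived; it suffices because \<open>h\<close> is chosen with a sign afterwards.\<close>

lemma subdiff_imp_weak:
  assumes p: "1 < p" and u: "u \<in> L2 \<nu>" and v: "(\<lambda>x. - v x) \<in> subdiff_L2 \<nu> (F_pm p \<nu> m) u"
    and h: "test_function \<nu> h"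
  shows "- 2 * (\<integral> x. h x * v x \<partial>\<nu>) \<le> (\<integral> z. pflux p (grad u z) * grad h z \<partial>J)"
proof -
  have um [measurable]: "u \<in> borel_measurable \<nu>" and hm [measurable]: "h \<in> borel_measurable \<nu>"
    using u h by (auto simp: L2_def test_function_def)
  note pflux_measurable[OF p, measurable]
  have iu: "integrable J (\<lambda>z. \<bar>grad u z\<bar> powr p)" by (rule subdiff_imp_integrable_grad[OF p u v])
  have ih: "integrable J (\<lambda>z. \<bar>grad h z\<bar> powr p)" by (rule integrable_grad_test_powr[OF p h])
  define t where "t n = 1 / real (Suc n)" for n
  have t: "0 < t n" "t n \<le> 1" for n by (auto simp: t_def)
  have t0: "t \<longlonglongrightarrow> 0" using LIMSEQ_inverse_real_of_nat by (simp add: t_def[abs_def] inverse_eq_divide)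
  define u' where "u' n x = u x + t n * h x" for n x
  have [measurable]: "u' n \<in> borel_measurable \<nu>" for n unfolding u'_def by measurable
  have gu': "grad (u' n) z = grad u z + t n * grad h z" for n z
    by (cases z) (simp add: grad_def u'_def algebra_simps)
  have iu': "integrable J (\<lambda>z. \<bar>grad (u' n) z\<bar> powr p)" for n
    unfolding gu' by (rule integrable_grad_add_cmult_powr[OF p um hm iu ih])
  have "- 2 * (\<integral> x. h x * v x \<partial>\<nu>) \<le> (\<integral> z. pflux p (grad (u' n) z) * grad h z \<partial>J)" for n
  proof -
    have "u' n \<in> L2 \<nu>"
      unfolding u'_def[abs_def] by (rule L2_add_cmult[OF u test_function_in_L2[OF h]])
    then have "ereal (L2_inner \<nu> (\<lambda>x. - v x) (\<lambda>x. u' n x - u x)) \<le> F_pm p \<nu> m (u' n) - F_pm p \<nu> m u"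
      using v by (simp add: subdiff_L2_def)
    moreover have "L2_inner \<nu> (\<lambda>x. - v x) (\<lambda>x. u' n x - u x) = - (\<integral> x. t n * (h x * v x) \<partial>\<nu>)"
      by (simp add: L2_inner_def u'_def mult_ac del: integral_mult_right_zero)
    ultimately have "- (t n * (\<integral> x. h x * v x \<partial>\<nu>))
        \<le> (\<integral> z. \<bar>grad (u' n) z\<bar> powr p \<partial>J) / (2 * p) - (\<integral> z. \<bar>grad u z\<bar> powr p \<partial>J) / (2 * p)"
      by (simp add: F_pm_eq_ereal[OF p iu'] F_pm_eq_ereal[OF p iu])
    then have "- (2 * p) * (t n * (\<integral> x. h x * v x \<partial>\<nu>))
        \<le> (\<integral> z. \<bar>grad (u' n) z\<bar> powr p \<partial>J) - (\<integral> z. \<bar>grad u z\<bar> powr p \<partial>J)"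
      using p by (simp add: field_simps)
    also have "\<dots> = (\<integral> z. \<bar>grad (u' n) z\<bar> powr p - \<bar>grad u z\<bar> powr p \<partial>J)"
      using iu iu' by simp
    \<comment> \<open>The tangent is taken at the perturbed gradient and evaluated at
      \<open>grad u\<close>, which bounds the increment from above. After division by
      \<open>p * t n\<close>, only the flux has to pass to the limit.\<close>
    also have "\<dots> \<le> (\<integral> z. (p * t n) * (pflux p (grad (u' n) z) * grad h z) \<partial>J)"
    proof (rule integral_mono)
      show "integrable J (\<lambda>z. (p * t n) * (pflux p (grad (u' n) z) * grad h z))"
        using integrable_pflux_mult[OF p _ hm iu' ih] by simp
      show "\<bar>grad (u' n) z\<bar> powr p - \<bar>grad u z\<bar> powr p
          \<le> (p * t n) * (pflux p (grad (u' n) z) * grad h z)" for z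
        using powr_tangent_le[OF p, of "grad (u' n) z" "grad u z"] by (simp add: gu' algebra_simps)
    qed (use iu iu' in auto)
    also have "\<dots> = (p * t n) * (\<integral> z. pflux p (grad (u' n) z) * grad h z \<partial>J)" by simp
    finally have "(p * t n) * (- 2 * (\<integral> x. h x * v x \<partial>\<nu>))
        \<le> (p * t n) * (\<integral> z. pflux p (grad (u' n) z) * grad h z \<partial>J)"
      by (simp add: mult_ac)
    moreover have "0 < p * t n" using p t by simp
    ultimately show ?thesis by (simp only: mult_le_cancel_left_pos)
  qed
  moreover have "(\<lambda>n. \<integral> z. pflux p (grad (u' n) z) * grad h z \<partial>J)
      \<longlonglongrightarrow> (\<integral> z. pflux p (grad u z) * grad h z \<partial>J)"
  proof (rule integral_dominated_convergence)
    \<comment> \<open>A majorant independent of n, because \<open>t n\<close> is at most 1.\<close>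
    let ?w = "\<lambda>z. 2 powr p * (\<bar>grad u z\<bar> powr p + \<bar>grad h z\<bar> powr p) + \<bar>grad h z\<bar> powr p"
    show "integrable J ?w" using iu ih by auto
    show "AE z in J. (\<lambda>n. pflux p (grad (u' n) z) * grad h z) \<longlonglongrightarrow> pflux p (grad u z) * grad h z"
    proof (intro AE_I2 tendsto_mult tendsto_const)
      fix z
      have "(\<lambda>n. grad u z + t n * grad h z) \<longlonglongrightarrow> grad u z + 0 * grad h z"
        by (intro tendsto_intros t0)
      then show "(\<lambda>n. pflux p (grad (u' n) z)) \<longlonglongrightarrow> pflux p (grad u z)"
        unfolding gu' using continuous_on_tendsto_compose[OF continuous_pflux[OF p]] by simp
    qed
    show "AE z in J. norm (pflux p (grad (u' n) z) * grad h z) \<le> ?w z" for n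
    proof (intro AE_I2)
      fix z
      have "norm (pflux p (grad (u' n) z) * grad h z) \<le> \<bar>grad (u' n) z\<bar> powr p + \<bar>grad h z\<bar> powr p"
        using abs_pflux_mult_le[OF p] by simp
      moreover have "\<bar>grad (u' n) z\<bar> powr p \<le> 2 powr p * (\<bar>grad u z\<bar> powr p + \<bar>t n * grad h z\<bar> powr p)"
        unfolding gu' by (rule abs_add_powr_le[OF p])
      moreover have "\<bar>t n * grad h z\<bar> powr p \<le> \<bar>grad h z\<bar> powr p"
        using p t[of n] by (intro powr_mono2) (auto simp: abs_mult mult_left_le_one_le)
      then have "2 powr p * (\<bar>grad u z\<bar> powr p + \<bar>t n * grad h z\<bar> powr p)
          \<le> 2 powr p * (\<bar>grad u z\<bar> powr p + \<bar>grad h z\<bar> powr p)"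
        by (intro mult_left_mono) auto
      ultimately show "norm (pflux p (grad (u' n) z) * grad h z) \<le> ?w z" by linarith
    qed
  qed measurable
  ultimately show ?thesis by (intro LIMSEQ_le_const) auto
qed

lemma subdiff_imp_p_laplacian:
  assumes p: "1 < p" and u: "u \<in> L2 \<nu>" and v: "v \<in> L2 \<nu>"
    and sub: "(\<lambda>x. - v x) \<in> subdiff_L2 \<nu> (F_pm p \<nu> m) u"
  shows "(u, v) \<in> p_laplacian p \<nu> m"
proof -
  have um [measurable]: "u \<in> borel_measurable \<nu>" and vm [measurable]: "v \<in> borel_measurable \<nu>"
    using u v by (auto simp: L2_def)
  note pflux_measurable[OF p, measurable]
  have iu: "integrable J (\<lambda>z. \<bar>grad u z\<bar> powr p)" by (rule subdiff_imp_integrable_grad[OF p u sub])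
  define a where "a x = (\<integral> y. pflux p (grad u (x, y)) \<partial>m x)" for x
  have [measurable]: "a \<in> borel_measurable \<nu>"
    unfolding a_def by (rule integral_kernel_measurable) measurable
  interpret sigma_finite_measure \<nu> using random_walk by (simp add: random_walk_space_def)
  obtain A where A: "range A \<subseteq> sets \<nu>" "(\<Union>i. A i) = space \<nu>" "\<And>i::nat. emeasure \<nu> (A i) \<noteq> \<infinity>"
    using sigma_finite by blast
  have "AE x in \<nu>. x \<in> A i \<longrightarrow> v x = a x" for i
  proof -
    have [measurable]: "A i \<in> sets \<nu>" using A(1) by auto
    \<comment> \<open>With this sign \<open>h * (v - a)\<close> is
      \<open>- \<bar>v - a\<bar>\<close> on \<open>A i\<close>, while the weak inequality and
      Green's formula make its integral nonnegative.\<close>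
    define h where "h x = - indicator (A i) x * sgn (v x - a x)" for x
    have [measurable]: "h \<in> borel_measurable \<nu>" unfolding h_def by measurable
    have "emeasure \<nu> {x \<in> space \<nu>. h x \<noteq> 0} \<le> emeasure \<nu> (A i)"
      by (intro emeasure_mono) (auto simp: h_def indicator_def)
    also have "\<dots> < \<infinity>" using A(3)[of i] by (simp add: less_top)
    finally have h: "test_function \<nu> h"
      unfolding test_function_def
      by (intro conjI exI[of _ 1]) (auto simp: h_def abs_mult indicator_def sgn_if)
    have *: "integrable J (\<lambda>z. pflux p (grad u z) * h (fst z))"
      by (rule integrable_pflux_test[OF p um iu h])
    \<comment> \<open>At this point \<open>a\<close> is not known to be in L^2; the integrability
      comes from that of the flux on \<open>J\<close>.\<close>
    have ha: "integrable \<nu> (\<lambda>x. h x * a x)"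
      unfolding a_def by (rule Green_integrable_divergence[OF pflux_grad_swap *])
    have hv: "integrable \<nu> (\<lambda>x. h x * v x)"
      by (rule L2_mult_integrable[OF test_function_in_L2[OF h] v])
    have "(\<integral> x. h x * a x \<partial>\<nu>) \<le> (\<integral> x. h x * v x \<partial>\<nu>)"
      using subdiff_imp_weak[OF p u sub h] Green[OF pflux_grad_swap *] by (simp add: a_def)
    then have "0 \<le> (\<integral> x. h x * v x - h x * a x \<partial>\<nu>)" using ha hv by simp
    moreover have eq: "h x * v x - h x * a x = - (indicator (A i) x * \<bar>v x - a x\<bar>)" for x
      by (auto simp: h_def indicator_def sgn_if)
    ultimately have "(\<integral> x. indicator (A i) x * \<bar>v x - a x\<bar> \<partial>\<nu>) \<le> 0" by simp
    moreover have "0 \<le> (\<integral> x. indicator (A i) x * \<bar>v x - a x\<bar> \<partial>\<nu>)" by simp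
    ultimately have "(\<integral> x. indicator (A i) x * \<bar>v x - a x\<bar> \<partial>\<nu>) = 0" by linarith
    moreover have "integrable \<nu> (\<lambda>x. indicator (A i) x * \<bar>v x - a x\<bar>)"
    proof -
      have "integrable \<nu> (\<lambda>x. - (h x * v x - h x * a x))" using ha hv by simp
      then show ?thesis unfolding eq by simp
    qed
    ultimately have "AE x in \<nu>. indicator (A i) x * \<bar>v x - a x\<bar> = 0"
      using integral_nonneg_eq_0_iff_AE[of \<nu> "\<lambda>x. indicator (A i) x * \<bar>v x - a x\<bar>"] by simp
    then show ?thesis by eventually_elim (auto simp: indicator_def)
  qed
  then have "AE x in \<nu>. \<forall>i. x \<in> A i \<longrightarrow> v x = a x" unfolding AE_all_countable by blast
  with AE_space have "AE x in \<nu>. v x = a x"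
    by eventually_elim (use A(2) in blast)
  then show ?thesis
    using u v iu unfolding p_laplacian_def a_def pflux_def by simp
qed

section \<open>Complete accretivity\<close>

text \<open>Test both weak forms with \<open>q (u1 - u2)\<close>. By monotonicity of
  \<open>q\<close> and of the flux, the gradient of this function and the difference of the fluxes
  never have opposite signs; the factor -2 reverses the resulting inequality.\<close>

lemma p_laplacian_monotone:
  assumes p: "1 < p" and uv: "(u1, v1) \<in> p_laplacian p \<nu> m" "(u2, v2) \<in> p_laplacian p \<nu> m"
    and q: "mono q" "\<And>s. \<bar>q s\<bar> \<le> C" "0 < e" "\<And>s. \<bar>s\<bar> < e \<Longrightarrow> q s = 0"
  shows "integrable \<nu> (\<lambda>x. q (u1 x - u2 x) * (v1 x - v2 x))" (is ?I)
    and "(\<integral> x. q (u1 x - u2 x) * (v1 x - v2 x) \<partial>\<nu>) \<le> 0"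
proof -
  note D1 = p_laplacianD[OF uv(1)] and D2 = p_laplacianD[OF uv(2)]
  let ?h = "\<lambda>x. q (u1 x - u2 x)"
  have h: "test_function \<nu> ?h"
    by (rule test_function_comp_L2[OF L2_diff[OF D1(1) D2(1)] borel_measurable_mono[OF q(1)] q(3,2,4)])
  have ih: "integrable J (\<lambda>z. \<bar>grad ?h z\<bar> powr p)" by (rule integrable_grad_test_powr[OF p h])
  have hm: "?h \<in> borel_measurable \<nu>" using h by (simp add: test_function_def)
  have hv: "integrable \<nu> (\<lambda>x. ?h x * v1 x)" "integrable \<nu> (\<lambda>x. ?h x * v2 x)"
    using test_function_in_L2[OF h] D1 D2 by (auto intro: L2_mult_integrable)
  then show ?I by (simp add: right_diff_distrib)
  have pf: "integrable J (\<lambda>z. pflux p (grad u1 z) * grad ?h z)"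
    "integrable J (\<lambda>z. pflux p (grad u2 z) * grad ?h z)"
    using integrable_pflux_mult[OF p _ hm _ ih] D1 D2 by auto
  have "0 \<le> (\<integral> z. pflux p (grad u1 z) * grad ?h z - pflux p (grad u2 z) * grad ?h z \<partial>J)"
  proof (rule Bochner_Integration.integral_nonneg)
    fix z :: "'a \<times> 'a"
    obtain x y where z: "z = (x, y)" by (cases z)
    show "0 \<le> pflux p (grad u1 z) * grad ?h z - pflux p (grad u2 z) * grad ?h z"
    \<comment> \<open>The condition says that \<open>u1 - u2\<close> is at least as large at
      \<open>y\<close> as at \<open>x\<close>, so it decides the sign of
      \<open>grad ?h z\<close>.\<close>
    proof (cases "grad u2 z \<le> grad u1 z")
      case True
      then have "0 \<le> grad ?h z" using q(1) by (auto simp: z grad_def intro: monoD)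
      with pflux_mono[OF p True] show ?thesis by (simp add: mult_right_mono)
    next
      case False
      then have "grad ?h z \<le> 0" using q(1) by (auto simp: z grad_def intro: monoD)
      with pflux_mono[OF p, of "grad u1 z" "grad u2 z"] False show ?thesis
        by (simp add: mult_right_mono_neg)
    qed
  qed
  also have "\<dots> = - 2 * (\<integral> x. ?h x * v1 x \<partial>\<nu>) + 2 * (\<integral> x. ?h x * v2 x \<partial>\<nu>)"
    using pf p_laplacian_weak_test[OF p uv(1) h] p_laplacian_weak_test[OF p uv(2) h] by simp
  finally show "(\<integral> x. ?h x * (v1 x - v2 x) \<partial>\<nu>) \<le> 0"
    using hv by (simp add: right_diff_distrib)
qed

text \<open>With w = u1 - u2 and V = v1 - v2, the subgradient inequality gives f (w - lam V) >= f w
  - lam q(w) V, and the last term has nonnegative integral by monotonicity. The minus sign before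
  lam reflects that \<open>v1\<close>, \<open>v2\<close> are values of the p-Laplacian, not of its
  negative.\<close>

lemma p_laplacian_accretive_regular:
  assumes p: "1 < p" and uv: "(u1, v1) \<in> p_laplacian p \<nu> m" "(u2, v2) \<in> p_laplacian p \<nu> m"
    and lam: "0 < lam"
    and sub: "\<And>s t. f s + q s * (t - s) \<le> f t" and f0: "\<And>s. 0 \<le> f s"
    and q: "\<And>s. \<bar>q s\<bar> \<le> C" "0 < e" "\<And>s. \<bar>s\<bar> < e \<Longrightarrow> f s = 0 \<and> q s = 0"
  shows "f \<in> borel_measurable borel"
    and "(\<integral>\<^sup>+ x. ennreal (f (u1 x - u2 x)) \<partial>\<nu>)
      \<le> (\<integral>\<^sup>+ x. ennreal (f (u1 x - u2 x - lam * (v1 x - v2 x))) \<partial>\<nu>)"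
proof -
  note D1 = p_laplacianD[OF uv(1)] and D2 = p_laplacianD[OF uv(2)]
  note D1(3,4)[measurable] D2(3,4)[measurable]
  have "mono q"
  proof (rule monoI)
    fix s t :: real assume "s \<le> t"
    \<comment> \<open>Sum of the subgradient inequalities at \<open>s\<close> and at
      \<open>t\<close>.\<close>
    have "q s * (t - s) \<le> q t * (t - s)"
      using sub[of s t] sub[of t s] by (simp add: algebra_simps)
    then show "q s \<le> q t" using \<open>s \<le> t\<close> by (cases "s = t") auto
  qed
  note mq = p_laplacian_monotone[OF p uv this q(1,2)]
  have C: "0 \<le> C" using q(1)[of 0] by linarith
  have "f s - f t \<le> C * \<bar>s - t\<bar>" for s t
  proof -
    have "f s - f t \<le> q s * (s - t)" using sub[of s t] by (simp add: algebra_simps)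
    also have "\<dots> \<le> \<bar>q s\<bar> * \<bar>s - t\<bar>" using abs_ge_self[of "q s * (s - t)"] by (simp add: abs_mult)
    also have "\<dots> \<le> C * \<bar>s - t\<bar>" by (intro mult_right_mono q(1)) auto
    finally show ?thesis .
  qed
  then have lip: "\<bar>f s - f t\<bar> \<le> C * \<bar>s - t\<bar>" for s t
    by (smt (verit) abs_minus_commute)
  then have "C-lipschitz_on UNIV f"
    using C by (intro lipschitz_onI) (auto simp: dist_real_def)
  then show fm [measurable]: "f \<in> borel_measurable borel"
    by (intro borel_measurable_continuous_onI lipschitz_on_continuous_on)
  let ?w = "\<lambda>x. u1 x - u2 x"
  have w: "?w \<in> L2 \<nu>" by (rule L2_diff[OF D1(1) D2(1)])
  have fw: "integrable \<nu> (\<lambda>x. f (?w x))"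
  proof (rule Bochner_Integration.integrable_bound)
    show "integrable \<nu> (\<lambda>x. (C / e) * (?w x)\<^sup>2)" using w by (simp add: L2_def)
    \<comment> \<open>\<open>f\<close> grows at most linearly and vanishes for
      \<open>\<bar>s\<bar> < e\<close>; elsewhere \<open>\<bar>s\<bar>\<close> is at most the square
      of \<open>s\<close> divided by \<open>e\<close>.\<close>
    have "f s \<le> (C / e) * s\<^sup>2" for s
    proof (cases "\<bar>s\<bar> < e")
      case True
      then show ?thesis using q C by simp
    next
      case False
      have "f s \<le> C * \<bar>s\<bar>" using lip[of s 0] q(2) q(3)[of 0] f0[of s] by simp
      also have "\<dots> \<le> C * (\<bar>s\<bar> * \<bar>s\<bar> / e)"
        using False q(2) C mult_right_mono[of e "\<bar>s\<bar>" "\<bar>s\<bar>"]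
        by (intro mult_left_mono) (auto simp: pos_le_divide_eq mult.commute)
      finally show ?thesis by (simp add: power2_eq_square)
    qed
    moreover have "0 \<le> (C / e) * s\<^sup>2" for s using C q(2) by simp
    ultimately show "AE x in \<nu>. norm (f (?w x)) \<le> norm ((C / e) * (?w x)\<^sup>2)"
      using f0 by (intro AE_I2) (simp only: real_norm_def abs_of_nonneg)
  qed measurable
  let ?g = "\<lambda>x. f (?w x - lam * (v1 x - v2 x))"
  show "(\<integral>\<^sup>+ x. ennreal (f (?w x)) \<partial>\<nu>) \<le> (\<integral>\<^sup>+ x. ennreal (?g x) \<partial>\<nu>)"
  proof (cases "integrable \<nu> ?g")
    case True
    have "(\<integral> x. f (?w x) \<partial>\<nu>) \<le> (\<integral> x. f (?w x) - lam * (q (?w x) * (v1 x - v2 x)) \<partial>\<nu>)"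
      using fw mq q(3) lam by (simp add: mult_nonneg_nonpos)
    also have "\<dots> \<le> (\<integral> x. ?g x \<partial>\<nu>)"
    proof (rule integral_mono)
      show "f (?w x) - lam * (q (?w x) * (v1 x - v2 x)) \<le> ?g x" for x
        using sub[of "?w x" "?w x - lam * (v1 x - v2 x)"] by (simp add: algebra_simps)
    qed (use True fw mq q(3) in auto)
    finally show ?thesis
      using f0 by (simp add: nn_integral_eq_integral[OF True] nn_integral_eq_integral[OF fw] ennreal_leI)
  next
    case False
    then have "(\<integral>\<^sup>+ x. ennreal (?g x) \<partial>\<nu>) = \<top>"
      by (rule nn_integral_eq_top[rotated]) (use f0 in auto)
    then show ?thesis by simp
  qed
qed

lemma p_laplacian_completely_accretive:
  assumes p: "1 < p"
  shows "completely_accretive \<nu> {(u, (\<lambda>x. - v x)) | u v. (u, v) \<in> p_laplacian p \<nu> m}"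
proof -
  have "(\<integral>\<^sup>+ x. j (u1 x - u2 x) \<partial>\<nu>) \<le> (\<integral>\<^sup>+ x. j (u1 x - u2 x + lam * (- v1 x - - v2 x)) \<partial>\<nu>)"
    if lam: "0 < lam" and uv: "(u1, v1) \<in> p_laplacian p \<nu> m" "(u2, v2) \<in> p_laplacian p \<nu> m"
      and j: "convex_ext j" "lsc j" "j 0 = 0" for lam u1 v1 u2 v2 j
  proof -
    obtain f q where fq:
      "\<And>n s t. f n s + q n s * (t - s) \<le> f n t"
      "\<And>n s. 0 \<le> f n s" "\<And>n s. ennreal (f n s) \<le> j s"
      "\<And>s. j s \<le> liminf (\<lambda>n. ennreal (f n s))"
      "\<And>n s. \<bar>q n s\<bar> \<le> real n"
      "\<And>n s. real n * real n * \<bar>s\<bar> < 1 \<Longrightarrow> f n s = 0 \<and> q n s = 0"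
      using convex_lsc_approx[OF j] by blast
    \<comment> \<open>The added 1 gives a positive radius also for n = 0 and keeps it inside the
      region where \<open>f n\<close> and \<open>q n\<close> vanish.\<close>
    have e: "0 < 1 / (real n * real n + 1)" for n by (simp add: add_nonneg_pos)
    have z: "f n s = 0 \<and> q n s = 0" if "\<bar>s\<bar> < 1 / (real n * real n + 1)" for n s
    proof -
      have "0 < real n * real n + 1" by (simp add: add_nonneg_pos)
      then have "(real n * real n + 1) * \<bar>s\<bar> < 1" using that by (simp add: field_simps)
      then show ?thesis by (intro fq(6)) (simp add: algebra_simps)
    qed
    note acc = p_laplacian_accretive_regular[OF p uv lam fq(1,2,5) e z]
    note acc(1)[measurable] p_laplacianD(3)[OF uv(1), measurable] p_laplacianD(3)[OF uv(2), measurable]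
    \<comment> \<open>Fatou's lemma is applied to the measurable \<open>f n\<close>;
      \<open>j\<close> enters only by pointwise comparison, below the liminf on the left and above
      each \<open>f n\<close> on the right.\<close>
    have "(\<integral>\<^sup>+ x. j (u1 x - u2 x) \<partial>\<nu>) \<le> (\<integral>\<^sup>+ x. liminf (\<lambda>n. ennreal (f n (u1 x - u2 x))) \<partial>\<nu>)"
      by (intro nn_integral_mono fq(4))
    also have "\<dots> \<le> liminf (\<lambda>n. \<integral>\<^sup>+ x. ennreal (f n (u1 x - u2 x)) \<partial>\<nu>)"
      by (intro nn_integral_liminf) measurable
    also have "\<dots> \<le> liminf (\<lambda>n::nat. \<integral>\<^sup>+ x. j (u1 x - u2 x - lam * (v1 x - v2 x)) \<partial>\<nu>)"
      by (intro Liminf_mono always_eventually allI order_trans[OF acc(2)] nn_integral_mono fq(3))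
    also have "\<dots> = (\<integral>\<^sup>+ x. j (u1 x - u2 x + lam * (- v1 x - - v2 x)) \<partial>\<nu>)"
      by (simp add: Liminf_const algebra_simps)
    finally show ?thesis .
  qed
  then show ?thesis unfolding completely_accretive_def by blast
qed

end

theorem theorem2p11:
  fixes \<nu> :: "'a measure" and m :: "'a \<Rightarrow> 'a measure" and p :: real
  assumes "random_walk_space \<nu> m" and "reversible \<nu> m" and "p > 1"
  shows "completely_accretive \<nu> {(u, (\<lambda>x. - v x)) | u v. (u, v) \<in> p_laplacian p \<nu> m} \<and>
         (\<forall>u\<in>L2 \<nu>. \<forall>v\<in>L2 \<nu>.
           (u, v) \<in> p_laplacian p \<nu> m \<longleftrightarrow> (\<lambda>x. - v x) \<in> subdiff_L2 \<nu> (F_pm p \<nu> m) u)"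
proof -
  interpret reversible_random_walk \<nu> m by standard (use assms in auto)
  show ?thesis
    using p_laplacian_completely_accretive p_laplacian_imp_subdiff subdiff_imp_p_laplacian assms(3)
    by blast
qed

end
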